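(* Let $n\ge 3$. The automorphism group of normalized second-order Fuchsian differential equations on $\mathbb{P}^1$ with $n$ singular points (including the transformation $\alpha\leftrightarrow\beta$ explicitly as an element) is isomorphic to $\mathcal{B}_n := \mathbb{Z}_2\wr S_n$, the group of signed permutations of an $n$-set. If the transformation $\alpha\leftrightarrow\beta$ is not explicitly included as an element, the automorphism group is isomorphic to $\mathcal{D}_n:=[\mathbb{Z}_2\wr S_n]_{\rm even}$, the group of even-signed permutations of an $n$-set. The transformation group of the canonical solution $F=F(x)$ is isomorphic to $\mathcal{B}_{n-1}$ if $\alpha\leftrightarrow\beta$ is included, and to $\mathcal{D}_{n-1}$ if $\alpha\leftrightarrow\beta$ is not explicitly included.
   Context: Normalized equations. A normalized second-order Fuchsian differential equation (FDE) with $n\ge3$ singular points is a linear homogeneous second-order equation on $\mathbb{P}^1_x$, all of whose singular points are regular, with labelled distinct singular points $a_1=0,\ a_2=1,\ a_3,\dots,a_{n-1},\ a_n=\infty$, with characteristic exponents $0,\theta_i$ at $a_i$ for $1\le i\le n-1$, and $\alpha,\ \beta:=\alpha+\theta_\infty$ at $\infty$ (exponent $\alpha$ at $\infty$ meaning behavior $x^{-\alpha}$). Write $\theta_n:=\theta_\infty$. Fuchs's relation (the exponents sum to $n-2$) forces $\alpha=(n-2-\theta_1-\cdots-\theta_{n-1}-\theta_\infty)/2$. The P-symbol of the equation is the labelled data $(a_i)_{i=1}^n,(\theta_i)_{i=1}^n$, the parameters being arbitrary; the equation also has $n-3$ accessory parameters, which are transformed accordingly. The automorphisms act on these normalized equations,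 more precisely on the set of all their labelled P-symbols, with the $\theta_i$ viewed as arbitrary parameters. F-homotopies. For $1\le i\le n-1$, multiplying the dependent variable by $(x-a_i)^{-\theta_i}$ replaces $\theta_i$ by $-\theta_i$ and leaves the other $\theta_j$ and all $a_j$ unchanged. The interchange $\alpha\leftrightarrow\beta$ of the two exponents at $\infty$ replaces $\theta_\infty$ by $-\theta_\infty$ and leaves everything else (including the differential equation itself) unchanged; it is the F-homotopy at $\infty$. Möbius automorphisms. For each permutation $\sigma\in S_n$ of the $n$ columns of the P-symbol, one relabels the columns according to $\sigma$, applies the unique Möbius transformation of $\mathbb{P}^1$ moving the columns now labelled $1,2,n$ to $0,1,\infty$ respectively, and multiplies the dependent variable by the power products needed to restore a zero exponent at each finite singular point; each exponent difference $\theta_i$ is carried along with its column. The automorphism group with $\alpha\leftrightarrow\beta$ included is the group generated, under composition, by all F-homotopies (including the one at $\infty$) and all Möbius automorphisms; each element permutes the columns and then negates some of the $\theta_i$. The automorphism group with $\alpha\leftrightarrow\beta$ not explicitly included is obtained by following each automorphism that performs an odd number of negations by $\theta_\infty\mapsto-\theta_\infty$, i.e. by keeping only the automorphisms with an even number of negations. Canonical solution. $F$ denotes the local solution at $x=0$ belonging to the exponent $0$, analytic there and normalized by $F(0)=1$, as a function of $x$ and of the parameters of the equation. Its transformation group (in either version) is the subgroup of the corresponding automorphism group consisting of the automorphisms that fix the singular point $x=0$ and perform no F-homotopy (no negation) there; each of these gives an identity expressing $F$ in terms of itself with transformed parameters and argument. $\mathbb{Z}_2\wr S_m=(\mathbb{Z}_2)^m\rtimes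 S_m$ is the group of signed permutations of an $m$-set, and $\mathcal{D}_m$ is its subgroup of signed permutations with an even number of minus signs. *)

theory Defs
  imports "HOL-Complex_Analysis.Complex_Analysis" "HOL-Algebra.Algebra"
begin

section \<open>The Riemann sphere and its Moebius transformations\<close>

datatype riemann_sphere = Fin complex | Infty

fun moebius :: "complex \<Rightarrow> complex \<Rightarrow> complex \<Rightarrow> complex \<Rightarrow> riemann_sphere \<Rightarrow> riemann_sphere" where
  "moebius a b c d (Fin z) =
     (if c * z + d = 0 then Infty else Fin ((a * z + b) / (c * z + d)))"
| "moebius a b c d Infty = (if c = 0 then Infty else Fin (a / c))"

definition is_moebius :: "(riemann_sphere \<Rightarrow> riemann_sphere) \<Rightarrow> bool" where
  "is_moebius m \<longleftrightarrow> (\<exists>a b c d. a * d - b * c \<noteq> 0 \<and> m = moebius a b c d)"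

definition moebius_to_01inf :: "riemann_sphere \<Rightarrow> riemann_sphere \<Rightarrow> riemann_sphere \<Rightarrow> riemann_sphere \<Rightarrow> riemann_sphere" where
  "moebius_to_01inf u v w =
     (THE m. is_moebius m \<and> m u = Fin 0 \<and> m v = Fin 1 \<and> m w = Infty)"


section \<open>Fuchsian equations and their P-symbols\<close>

text \<open>
  A P-symbol with \<open>n\<close> columns is a function on the labels \<open>1, \<dots>, n\<close> (extensional, i.e.
  \<open>undefined\<close> at all other arguments).  A column consists of a point and an ordered pair of
  characteristic exponents.
\<close>

type_synonym psymbol = "nat \<Rightarrow> riemann_sphere \<times> complex \<times> complex"

definition point :: "psymbol \<Rightarrow> nat \<Rightarrow> riemann_sphere" where
  "point P i = fst (P i)"

definition exp1 :: "psymbol \<Rightarrow> nat \<Rightarrow> complex" where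
  "exp1 P i = fst (snd (P i))"

definition exp2 :: "psymbol \<Rightarrow> nat \<Rightarrow> complex" where
  "exp2 P i = snd (snd (P i))"

definition theta :: "psymbol \<Rightarrow> nat \<Rightarrow> complex" where
  "theta P i = exp2 P i - exp1 P i"

text \<open>
  \<open>has_exponents p q x r s\<close>: the equation \<open>y'' + p y' + q y = 0\<close> has at \<open>x\<close> an at most regular
  singular point, and \<open>r\<close>, \<open>s\<close> are the roots, with multiplicity, of the indicial polynomial
  there.  That polynomial is the leading coefficient obtained by inserting
  \<open>y = (z - a) powr \<rho>\<close> at a finite point \<open>a\<close>, and \<open>y = z powr (- \<rho>)\<close> at infinity.
\<close>

fun has_exponents ::
  "(complex \<Rightarrow> complex) \<Rightarrow> (complex \<Rightarrow> complex) \<Rightarrow> riemann_sphere \<Rightarrow> complex \<Rightarrow> complex \<Rightarrow> bool" where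
  "has_exponents p q (Fin a) r s \<longleftrightarrow>
     (\<exists>p0 q0. ((\<lambda>z. (z - a) * p z) \<longlongrightarrow> p0) (at a) \<and>
              ((\<lambda>z. (z - a)\<^sup>2 * q z) \<longlongrightarrow> q0) (at a) \<and>
              (\<forall>\<rho>. \<rho> * (\<rho> - 1) + p0 * \<rho> + q0 = (\<rho> - r) * (\<rho> - s)))"
| "has_exponents p q Infty r s \<longleftrightarrow>
     (\<exists>p0 q0. ((\<lambda>z. z * p z) \<longlongrightarrow> p0) at_infinity \<and>
              ((\<lambda>z. z\<^sup>2 * q z) \<longlongrightarrow> q0) at_infinity \<and>
              (\<forall>\<rho>. \<rho> * (\<rho> + 1) - p0 * \<rho> + q0 = (\<rho> - r) * (\<rho> - s)))"

text \<open>
  \<open>y'' + p y' + q y = 0\<close> is Fuchsian with P-symbol \<open>P\<close>.  The parameters being arbitrary, a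
  listed point is allowed to degenerate to an ordinary point of the equation, which can only
  happen if its exponents differ by \<open>1\<close> or \<open>- 1\<close>.
\<close>

definition fuchsian :: "nat \<Rightarrow> (complex \<Rightarrow> complex) \<Rightarrow> (complex \<Rightarrow> complex) \<Rightarrow> psymbol \<Rightarrow> bool" where
  "fuchsian n p q P \<longleftrightarrow>
     p holomorphic_on {z. Fin z \<notin> point P ` {1..n}} \<and>
     q holomorphic_on {z. Fin z \<notin> point P ` {1..n}} \<and>
     Infty \<in> point P ` {1..n} \<and>
     (\<forall>i\<in>{1..n}. has_exponents p q (point P i) (exp1 P i) (exp2 P i))"

definition normalized :: "nat \<Rightarrow> psymbol \<Rightarrow> bool" where
  "normalized n P \<longleftrightarrow>
     inj_on (point P) {1..n} \<and>
     point P 1 = Fin 0 \<and> point P 2 = Fin 1 \<and> point P n = Infty \<and>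
     (\<forall>i\<in>{1..<n}. exp1 P i = 0)"

text \<open>
  The labelled P-symbols of the normalized equations.  The exponents \<open>\<alpha>\<close> and \<open>\<beta>\<close> at infinity
  are \<open>exp1 P n\<close> and \<open>exp2 P n\<close>.  Fuchs's relation is not imposed: it follows from the existence
  of the equation, so that such a P-symbol amounts to the points and the \<open>theta P i\<close>.
\<close>

definition psymbols :: "nat \<Rightarrow> psymbol set" where
  "psymbols n = {P \<in> extensional {1..n}. normalized n P \<and> (\<exists>p q. fuchsian n p q P)}"


section \<open>F-homotopies and Moebius automorphisms\<close>

text \<open>
  Effect on a P-symbol, whose last column is at infinity, of multiplying the dependent variable
  by the product of \<open>(z - a\<^sub>i) powr c i\<close> over \<open>i \<in> {1..<n}\<close>.
\<close>

definition multiply_powers :: "nat \<Rightarrow> (nat \<Rightarrow> complex) \<Rightarrow> psymbol \<Rightarrow> psymbol" where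
  "multiply_powers n c P =
     (\<lambda>i\<in>{1..n}. let s = (if i < n then c i else - (\<Sum>j\<in>{1..<n}. c j))
                 in (point P i, exp1 P i + s, exp2 P i + s))"

definition swap_exponents :: "nat \<Rightarrow> psymbol \<Rightarrow> psymbol" where
  "swap_exponents i P = P(i := (point P i, exp2 P i, exp1 P i))"

text \<open>
  For \<open>i < n\<close> the multiplication turns the exponents \<open>0, \<theta>\<^sub>i\<close> into \<open>- \<theta>\<^sub>i, 0\<close>; listing the zero
  exponent first again makes the new exponent difference equal to \<open>- \<theta>\<^sub>i\<close>.
\<close>

definition f_homotopy :: "nat \<Rightarrow> nat \<Rightarrow> psymbol \<Rightarrow> psymbol" where
  "f_homotopy n i P =
     (if i < n
      then swap_exponents i (multiply_powers n (\<lambda>j. if j = i then - theta P i else 0) P)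
      else swap_exponents n P)"

text \<open>The column labelled \<open>j\<close> gets the new label \<open>\<sigma> j\<close>.\<close>

definition relabel :: "nat \<Rightarrow> (nat \<Rightarrow> nat) \<Rightarrow> psymbol \<Rightarrow> psymbol" where
  "relabel n \<sigma> P = (\<lambda>i\<in>{1..n}. P (inv_into UNIV \<sigma> i))"

definition move_points :: "nat \<Rightarrow> (riemann_sphere \<Rightarrow> riemann_sphere) \<Rightarrow> psymbol \<Rightarrow> psymbol" where
  "move_points n m P = (\<lambda>i\<in>{1..n}. (m (point P i), exp1 P i, exp2 P i))"

definition moebius_automorphism :: "nat \<Rightarrow> (nat \<Rightarrow> nat) \<Rightarrow> psymbol \<Rightarrow> psymbol" where
  "moebius_automorphism n \<sigma> P =
     (let Q = relabel n \<sigma> P;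
          R = move_points n (moebius_to_01inf (point Q 1) (point Q 2) (point Q n)) Q
      in multiply_powers n (\<lambda>i. - exp1 R i) R)"


section \<open>The automorphism groups\<close>

definition generators :: "nat \<Rightarrow> (psymbol \<Rightarrow> psymbol) set" where
  "generators n =
     {restrict (f_homotopy n i) (psymbols n) | i. i \<in> {1..n}} \<union>
     {restrict (moebius_automorphism n \<sigma>) (psymbols n) | \<sigma>. \<sigma> permutes {1..n}}"

definition automorphism_group :: "nat \<Rightarrow> (psymbol \<Rightarrow> psymbol) monoid" where
  "automorphism_group n =
     (BijGroup (psymbols n))\<lparr>carrier := generate (BijGroup (psymbols n)) (generators n)\<rparr>"

text \<open>
  \<open>g\<close> permutes the columns according to \<open>\<sigma>\<close> and then negates the exponent differences of the
  columns now carrying the labels in \<open>N\<close>.  Since the exponent differences are arbitrary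
  parameters, \<open>\<sigma>\<close> and \<open>N\<close> are determined by \<open>g\<close>.
\<close>

definition acts_by :: "nat \<Rightarrow> (psymbol \<Rightarrow> psymbol) \<Rightarrow> (nat \<Rightarrow> nat) \<Rightarrow> nat set \<Rightarrow> bool" where
  "acts_by n g \<sigma> N \<longleftrightarrow>
     \<sigma> permutes {1..n} \<and> N \<subseteq> {1..n} \<and>
     (\<forall>P\<in>psymbols n.
        (\<exists>m. is_moebius m \<and> (\<forall>j\<in>{1..n}. point (g P) (\<sigma> j) = m (point P j))) \<and>
        (\<forall>j\<in>{1..n}. theta (g P) (\<sigma> j) = (if \<sigma> j \<in> N then - theta P j else theta P j)))"

text \<open>The version in which \<open>\<alpha> \<leftrightarrow> \<beta>\<close> is not explicitly included.\<close>

definition even_automorphism_group :: "nat \<Rightarrow> (psymbol \<Rightarrow> psymbol) monoid" where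
  "even_automorphism_group n =
     (automorphism_group n)
       \<lparr>carrier := {g \<in> carrier (automorphism_group n). \<exists>\<sigma> N. acts_by n g \<sigma> N \<and> even (card N)}\<rparr>"

text \<open>
  The transformation group, inside a group \<open>A\<close> of automorphisms, of the canonical solution, i.e.
  of the solution at \<open>x = 0\<close> (the first column) with exponent \<open>0\<close> and value \<open>1\<close> there.
\<close>

definition canonical_transformations ::
  "nat \<Rightarrow> (psymbol \<Rightarrow> psymbol) monoid \<Rightarrow> (psymbol \<Rightarrow> psymbol) monoid" where
  "canonical_transformations n A =
     A\<lparr>carrier := {g \<in> carrier A. \<exists>\<sigma> N. acts_by n g \<sigma> N \<and> \<sigma> 1 = 1 \<and> 1 \<notin> N}\<rparr>"


section \<open>Signed permutations\<close>

definition wreath_sym :: "'a monoid \<Rightarrow> nat \<Rightarrow> ((nat \<Rightarrow> 'a) \<times> (nat \<Rightarrow> nat)) monoid" where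
  "wreath_sym G m =
     \<lparr>carrier = ({1..m} \<rightarrow>\<^sub>E carrier G) \<times> {\<sigma>. \<sigma> permutes {1..m}},
      mult = (\<lambda>(e, \<sigma>) (d, \<tau>). (\<lambda>i\<in>{1..m}. e i \<otimes>\<^bsub>G\<^esub> d (inv_into UNIV \<sigma> i), \<sigma> \<circ> \<tau>)),
      one = (\<lambda>i\<in>{1..m}. \<one>\<^bsub>G\<^esub>, id)\<rparr>"

definition signed_perms :: "nat \<Rightarrow> ((nat \<Rightarrow> int) \<times> (nat \<Rightarrow> nat)) monoid" where
  "signed_perms m = wreath_sym (integer_mod_group 2) m"

definition even_signed_perms :: "nat \<Rightarrow> ((nat \<Rightarrow> int) \<times> (nat \<Rightarrow> nat)) monoid" where
  "even_signed_perms m =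
     (signed_perms m)
       \<lparr>carrier := {(e, \<sigma>) \<in> carrier (signed_perms m). even (card {i \<in> {1..m}. e i = 1})}\<rparr>"

end

theory Submission
  imports Defs
begin

text \<open>
  A normalized P-symbol is the same thing as its points together with its exponent differences
  \<open>\<theta>\<^sub>1, \<dots>, \<theta>\<^sub>n\<close>.  The exponents at the finite points are \<open>0\<close> and \<open>\<theta>\<^sub>i\<close>, and Fuchs's relation
  determines the sum of the two exponents at infinity.  Conversely every choice of distinct points
  and of \<open>\<theta>\<^sub>i\<close> occurs, since Fuchs's relation is also sufficient for an equation to exist
  (\<open>psymbols_eq\<close>).  The relation is the residue theorem for the coefficient \<open>p\<close>, and is obtained from
  Liouville's theorem (\<open>sum_of_residues\<close>).

  In these coordinates the F-homotopies negate one \<open>\<theta>\<^sub>i\<close>, and a Moebius automorphism permutes the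
  columns and then moves the points by a Moebius transformation.  Composites and inverses of such
  maps again permute the columns and negate some \<open>\<theta>\<^sub>i\<close>, which is the relation \<open>acts_by\<close>.  This
  relation matches automorphisms with signed permutations in both directions.  The signed
  permutation determines the automorphism, because only one Moebius transformation moves three
  given points to \<open>0\<close>, \<open>1\<close>, \<open>\<infinity>\<close> (\<open>acts_by_determines\<close>).  The automorphism determines the
  signed permutation, because the \<open>\<theta>\<^sub>i\<close> are free parameters and can be taken nonzero and distinct up to
  sign (\<open>acts_by_unique\<close>).  Every signed permutation is a Moebius automorphism followed by
  F-homotopies (\<open>generate_generators_realizes\<close>).  So the automorphism group is the group of
  signed permutations of \<open>n\<close> labels (\<open>signed_perm_of_iso\<close>).

  The even automorphisms correspond to the signed permutations with an even number of minus
  signs, and the transformations of the canonical solution to those that fix the first label with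
  a plus sign.  The latter are the signed permutations of the other \<open>n - 1\<close> labels
  (\<open>drop_first_iso\<close>), with the same number of minus signs.
\<close>

section \<open>Moebius transformations\<close>

lemma moebius_moebius:
  assumes "a * d - b * c \<noteq> 0" "a' * d' - b' * c' \<noteq> 0"
  shows "moebius a b c d (moebius a' b' c' d' x) =
    moebius (a * a' + b * c') (a * b' + b * d') (c * a' + d * c') (c * b' + d * d') x"
proof (cases x)
  case (Fin z)
  let ?u = "a' * z + b'" and ?v = "c' * z + d'"
  have num: "(a * a' + b * c') * z + (a * b' + b * d') = a * ?u + b * ?v"
    and den: "(c * a' + d * c') * z + (c * b' + d * d') = c * ?u + d * ?v"
    by (simp_all add: algebra_simps)
  show ?thesis
  proof (cases "?v = 0")
    case True
    have "a' * d' - b' * c' = a' * ?v - c' * ?u" by (simp add: algebra_simps)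
    with True assms(2) have "?u \<noteq> 0" by auto
    then show ?thesis using True unfolding Fin moebius.simps num den by simp
  next
    case False
    then have "c * (?u / ?v) + d = (c * ?u + d * ?v) / ?v"
      and "a * (?u / ?v) + b = (a * ?u + b * ?v) / ?v" by (simp_all add: field_simps)
    then show ?thesis using False unfolding Fin moebius.simps num den by simp
  qed
next
  case Infty
  show ?thesis
  proof (cases "c' = 0")
    case True
    with assms(2) have "a' \<noteq> 0" by auto
    then show ?thesis using True Infty by simp
  next
    case False
    then have "c * (a' / c') + d = (c * a' + d * c') / c'"
      and "a * (a' / c') + b = (a * a' + b * c') / c'" by (simp_all add: field_simps)
    then show ?thesis using False Infty by simp
  qed
qed

lemma moebius_scalar: "a \<noteq> 0 \<Longrightarrow> moebius a 0 0 a = id"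
proof
  fix x assume "a \<noteq> 0" then show "moebius a 0 0 a x = id x" by (cases x) auto
qed

lemma is_moebius_id: "is_moebius id"
  unfolding is_moebius_def using moebius_scalar[of 1] by (metis diff_zero mult_1 mult_zero_left one_neq_zero)

lemma is_moebius_comp:
  assumes "is_moebius m" "is_moebius k"
  shows "is_moebius (m \<circ> k)"
proof -
  obtain a b c d where m: "a * d - b * c \<noteq> 0" "m = moebius a b c d"
    using assms(1) unfolding is_moebius_def by blast
  obtain a' b' c' d' where k: "a' * d' - b' * c' \<noteq> 0" "k = moebius a' b' c' d'"
    using assms(2) unfolding is_moebius_def by blast
  have "m \<circ> k = moebius (a * a' + b * c') (a * b' + b * d') (c * a' + d * c') (c * b' + d * d')"
    using moebius_moebius[OF m(1) k(1)] m(2) k(2) by auto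
  moreover have "(a * a' + b * c') * (c * b' + d * d') - (a * b' + b * d') * (c * a' + d * c')
      = (a * d - b * c) * (a' * d' - b' * c')"
    by (simp add: algebra_simps)
  ultimately show ?thesis
    using m(1) k(1) unfolding is_moebius_def by (metis mult_eq_0_iff)
qed

lemma is_moebius_inverse:
  assumes "is_moebius m"
  obtains k where "is_moebius k" "k \<circ> m = id" "m \<circ> k = id"
proof -
  obtain a b c d where m: "a * d - b * c \<noteq> 0" "m = moebius a b c d"
    using assms unfolding is_moebius_def by blast
  let ?k = "moebius d (- b) (- c) a"
  have det: "d * a - (- b) * (- c) \<noteq> 0" using m(1) by (simp add: algebra_simps)
  have "(?k \<circ> m) x = moebius (a * d - b * c) 0 0 (a * d - b * c) x"
       "(m \<circ> ?k) x = moebius (a * d - b * c) 0 0 (a * d - b * c) x" for x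
    using moebius_moebius[OF det m(1), of x] moebius_moebius[OF m(1) det, of x]
    by (simp_all add: m(2) algebra_simps)
  then have "?k \<circ> m = id" "m \<circ> ?k = id" using moebius_scalar[OF m(1)] by auto
  then show thesis using that det unfolding is_moebius_def by blast
qed

lemma is_moebius_inj: "is_moebius m \<Longrightarrow> inj m"
  by (erule is_moebius_inverse) (metis comp_eq_dest_lhs id_apply injI)

lemma moebius_fix_01inf:
  assumes "is_moebius m" "m (Fin 0) = Fin 0" "m (Fin 1) = Fin 1" "m Infty = Infty"
  shows "m = id"
proof -
  obtain a b c d where m: "a * d - b * c \<noteq> 0" "m = moebius a b c d"
    using assms(1) unfolding is_moebius_def by blast
  have "c = 0" using assms(4) m(2) by (auto split: if_splits)
  moreover from this have "d \<noteq> 0" using m(1) by auto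
  moreover from calculation have "b = 0" using assms(2) m(2) by auto
  moreover from calculation have "a = d" using assms(3) m(2) by auto
  ultimately show ?thesis unfolding m(2) using moebius_scalar[of d] by simp
qed

text \<open>
  The quotient \<open>k \<circ> m\<inverse>\<close> fixes \<open>0\<close>, \<open>1\<close> and \<open>\<infinity>\<close>, which leaves only the identity.
\<close>

lemma moebius_unique:
  assumes m: "is_moebius m" "m u = Fin 0" "m v = Fin 1" "m w = Infty"
    and k: "is_moebius k" "k u = Fin 0" "k v = Fin 1" "k w = Infty"
  shows "m = k"
proof -
  obtain l where l: "is_moebius l" "l \<circ> m = id" "m \<circ> l = id"
    using is_moebius_inverse[OF m(1)] .
  have "k \<circ> l = id"
    using is_moebius_comp[OF k(1) l(1)] pointfree_idE[OF l(2)] m k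
    by (intro moebius_fix_01inf) (metis comp_apply)+
  then have "k \<circ> (l \<circ> m) = m" by (simp flip: comp_assoc)
  then show ?thesis using l(2) by simp
qed

text \<open>
  The transformation is the cross ratio \<open>z \<mapsto> (z - u) (v - w) / ((z - w) (v - u))\<close>; when one of the
  three points is infinite, the two factors containing it are dropped.
\<close>

lemma moebius_exists:
  assumes "u \<noteq> v" "u \<noteq> w" "v \<noteq> w"
  shows "\<exists>m. is_moebius m \<and> m u = Fin 0 \<and> m v = Fin 1 \<and> m w = Infty"
proof -
  have *: ?thesis if "a * d - b * c \<noteq> 0" "moebius a b c d u = Fin 0"
    "moebius a b c d v = Fin 1" "moebius a b c d w = Infty" for a b c d
    using that unfolding is_moebius_def by blast
  show ?thesis
  proof (cases u)
    case u: Infty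
    obtain y z where "v = Fin y" "w = Fin z" using assms u by (metis riemann_sphere.exhaust)
    then show ?thesis using assms u by (intro *[of 0 "- z" "y - z" 1]) auto
  next
    case u: (Fin x)
    show ?thesis
    proof (cases v)
      case v: Infty
      obtain z where "w = Fin z" using assms v by (metis riemann_sphere.exhaust)
      then show ?thesis using assms u v by (intro *[of 1 "- z" "- x" 1]) auto
    next
      case v: (Fin y)
      show ?thesis
      proof (cases w)
        case Infty
        then show ?thesis using assms u v by (intro *[of 1 "y - x" "- x" 0]) auto
      next
        case w: (Fin z)
        have "(y - z) * (- z * (y - x)) - (- x * (y - z)) * (y - x) = (y - z) * (y - x) * (x - z)"
          by (simp add: algebra_simps)
        moreover have "(y - x) * y + - z * (y - x) = (y - x) * (y - z)"
          "(y - z) * y + - x * (y - z) = (y - x) * (y - z)"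
          "(y - x) * x + - z * (y - x) = (y - x) * (x - z)"
          by (simp_all add: algebra_simps)
        ultimately show ?thesis using assms u v w
          by (intro *[of "y - z" "- z * (y - x)" "- x * (y - z)" "y - x"]) auto
      qed
    qed
  qed
qed

lemma moebius_to_01inf:
  assumes "u \<noteq> v" "u \<noteq> w" "v \<noteq> w"
  shows "is_moebius (moebius_to_01inf u v w)"
    "moebius_to_01inf u v w u = Fin 0"
    "moebius_to_01inf u v w v = Fin 1"
    "moebius_to_01inf u v w w = Infty"
proof -
  have "\<exists>!m. is_moebius m \<and> m u = Fin 0 \<and> m v = Fin 1 \<and> m w = Infty"
  proof (rule ex_ex1I)
    fix m k
    assume "is_moebius m \<and> m u = Fin 0 \<and> m v = Fin 1 \<and> m w = Infty"
      and "is_moebius k \<and> k u = Fin 0 \<and> k v = Fin 1 \<and> k w = Infty"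
    then show "m = k" by (intro moebius_unique[of m u v w k]) auto
  qed (rule moebius_exists[OF assms])
  from theI'[OF this] show "is_moebius (moebius_to_01inf u v w)"
    "moebius_to_01inf u v w u = Fin 0"
    "moebius_to_01inf u v w v = Fin 1"
    "moebius_to_01inf u v w w = Infty"
    unfolding moebius_to_01inf_def by auto
qed

section \<open>Functions with finitely many simple poles\<close>

text \<open>
  A singularity at \<open>a\<close> with \<open>(z - a) f(z) \<rightarrow> 0\<close> is removable (Riemann), and the points of a finite
  set are isolated from one another, so that they can be removed one at a time.
\<close>

lemma removable_singularities:
  fixes f :: "complex \<Rightarrow> complex"
  assumes "finite A" "f holomorphic_on - A"
    and "\<And>a. a \<in> A \<Longrightarrow> ((\<lambda>z. (z - a) * f z) \<longlongrightarrow> 0) (at a)"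
  shows "\<exists>g. g holomorphic_on UNIV \<and> (\<forall>z. z \<notin> A \<longrightarrow> g z = f z)"
  using assms
proof (induction A arbitrary: f rule: finite_induct)
  case empty
  then show ?case by auto
next
  case (insert a A)
  have "f holomorphic_on (- A) - {a}"
    using insert.prems(1) by (metis Compl_insert)
  moreover have "open (- A)" using insert.hyps(1) by (simp add: finite_imp_closed open_Compl)
  then have "a \<in> interior (- A)" using insert.hyps(2) by (simp add: interior_open)
  ultimately obtain g where g: "g holomorphic_on - A" "\<forall>z\<in>- A - {a}. g z = f z"
    using holomorphic_on_extend_lim[of f "- A" a] insert.prems(2)[of a] by auto
  have "((\<lambda>z. (z - b) * g z) \<longlongrightarrow> 0) (at b)" if "b \<in> A" for b
  proof -
    have "open (- (insert a A - {b}))"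
      using insert.hyps(1) by (intro open_Compl finite_imp_closed) auto
    then have ev: "\<forall>\<^sub>F z in at b. (z - b) * f z = (z - b) * g z"
      unfolding eventually_at_topological
      using g(2) by (intro exI[of _ "- (insert a A - {b})"]) auto
    have "((\<lambda>z. (z - b) * f z) \<longlongrightarrow> 0) (at b)"
      using insert.prems(2) that by blast
    then show ?thesis using ev by (rule Lim_transform_eventually)
  qed
  then obtain h where "h holomorphic_on UNIV" "\<forall>z. z \<notin> A \<longrightarrow> h z = g z"
    using insert.IH[of g] g(1) by auto
  then show ?case using g(2) by auto
qed

lemma simple_pole_sum_tendsto:
  fixes r :: "'i \<Rightarrow> complex"
  assumes "finite I" "inj_on a I" "k \<in> I"
  shows "((\<lambda>z. (z - a k) * (\<Sum>i\<in>I. r i / (z - a i))) \<longlongrightarrow> r k) (at (a k))"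
proof -
  have "((\<lambda>z. r k + (z - a k) * (\<Sum>i\<in>I - {k}. r i / (z - a i))) \<longlongrightarrow>
      (r k + (a k - a k) * (\<Sum>i\<in>I - {k}. r i / (a k - a i)))) (at (a k))"
    using assms by (intro tendsto_intros) (auto dest: inj_onD)
  \<comment> \<open>Off the pole itself, \<open>z - a k\<close> cancels against the \<open>k\<close>-th denominator.\<close>
  moreover have "\<forall>\<^sub>F z in at (a k). r k + (z - a k) * (\<Sum>i\<in>I - {k}. r i / (z - a i)) =
      (z - a k) * (\<Sum>i\<in>I. r i / (z - a i))"
    unfolding eventually_at_topological
    using assms by (intro exI[of _ UNIV]) (auto simp: sum.remove[of I k] distrib_left)
  ultimately show ?thesis by (auto elim: Lim_transform_eventually)
qed

text \<open>
  Each summand is \<open>z r / (z - a) = r + r a / (z - a)\<close>, and the second term dies at infinity.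
\<close>

lemma simple_pole_sum_tendsto_infinity:
  fixes a r :: "'i \<Rightarrow> complex"
  shows "((\<lambda>z. z * (\<Sum>i\<in>I. r i / (z - a i))) \<longlongrightarrow> (\<Sum>i\<in>I. r i)) at_infinity"
proof -
  have "((\<lambda>z. z * (r i / (z - a i))) \<longlongrightarrow> r i) at_infinity" for i
  proof -
    have "filterlim (\<lambda>z. z - a i) at_infinity at_infinity"
      using tendsto_add_filterlim_at_infinity'[OF filterlim_ident tendsto_const, of "- a i"] by simp
    then have "((\<lambda>z. r i + r i * a i * inverse (z - a i)) \<longlongrightarrow> r i + r i * a i * 0) at_infinity"
      by (intro tendsto_intros filterlim_compose[OF tendsto_inverse_0])
    moreover have "\<forall>\<^sub>F z in at_infinity. r i + r i * a i * inverse (z - a i) = z * (r i / (z - a i))"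
      using eventually_not_equal_at_infinity[of "a i"]
      by eventually_elim (simp add: field_simps)
    ultimately show ?thesis by (auto elim: Lim_transform_eventually)
  qed
  then show ?thesis unfolding sum_distrib_left by (intro tendsto_sum)
qed

text \<open>
  The residue theorem for a function \<open>p\<close> that has at most simple poles in the plane and is \<open>O(1/z)\<close>
  at infinity, in the form of a decomposition into partial fractions: subtracting from \<open>p\<close> its polar
  parts leaves an entire function vanishing at infinity, which is zero by Liouville's theorem.
\<close>

lemma sum_of_residues:
  fixes p :: "complex \<Rightarrow> complex"
  assumes I: "finite I" "inj_on a I" and p: "p holomorphic_on - (a ` I)"
    and res: "\<And>i. i \<in> I \<Longrightarrow> ((\<lambda>z. (z - a i) * p z) \<longlongrightarrow> r i) (at (a i))"
    and inf: "((\<lambda>z. z * p z) \<longlongrightarrow> s) at_infinity"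
  shows "s = (\<Sum>i\<in>I. r i)"
proof -
  have to_zero: "(f \<longlongrightarrow> 0) at_infinity"
    if f: "((\<lambda>z. z * f z) \<longlongrightarrow> l) at_infinity" for f :: "complex \<Rightarrow> complex" and l
  proof -
    have "((\<lambda>z. inverse z * (z * f z)) \<longlongrightarrow> 0 * l) at_infinity"
      by (intro tendsto_mult tendsto_inverse_0 f)
    moreover have "\<forall>\<^sub>F z in at_infinity. inverse z * (z * f z) = f z"
      using eventually_not_equal_at_infinity[of "0::complex"] by eventually_elim auto
    ultimately show ?thesis by (auto elim: Lim_transform_eventually)
  qed
  define h where "h = (\<lambda>z. \<Sum>i\<in>I. r i / (z - a i))"
  have h_inf: "((\<lambda>z. z * h z) \<longlongrightarrow> (\<Sum>i\<in>I. r i)) at_infinity"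
    unfolding h_def by (rule simple_pole_sum_tendsto_infinity)
  define f where "f = (\<lambda>z. p z - h z)"
  have "f holomorphic_on - (a ` I)"
    unfolding f_def h_def using p by (auto intro!: holomorphic_intros)
  moreover have "((\<lambda>z. (z - a i) * f z) \<longlongrightarrow> 0) (at (a i))" if "i \<in> I" for i
  proof -
    have "((\<lambda>z. (z - a i) * h z) \<longlongrightarrow> r i) (at (a i))"
      unfolding h_def using simple_pole_sum_tendsto[OF I that] .
    from tendsto_diff[OF res[OF that] this] show ?thesis by (simp add: f_def algebra_simps)
  qed
  ultimately obtain g where g: "g holomorphic_on UNIV" "\<forall>z. z \<notin> a ` I \<longrightarrow> g z = f z"
    using removable_singularities[of "a ` I" f] I(1) by blast
  have "\<forall>\<^sub>F z in at_infinity. \<forall>i\<in>I. z \<noteq> a i"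
    using I(1) by (intro eventually_ball_finite) (auto intro: eventually_not_equal_at_infinity)
  then have f_eq_g: "\<forall>\<^sub>F z in at_infinity. f z = g z"
    by eventually_elim (use g(2) in auto)
  have "(f \<longlongrightarrow> 0) at_infinity"
    unfolding f_def using tendsto_diff[OF to_zero[OF inf] to_zero[OF h_inf]] by simp
  then have "(g \<longlongrightarrow> 0) at_infinity" using f_eq_g by (rule Lim_transform_eventually)
  then have g_zero: "g z = 0" for z by (rule Liouville_weak_0[OF g(1)])
  have "\<forall>\<^sub>F z in at_infinity. z * h z = z * p z"
    using f_eq_g by eventually_elim (simp add: g_zero f_def)
  with h_inf have "((\<lambda>z. z * p z) \<longlongrightarrow> (\<Sum>i\<in>I. r i)) at_infinity"
    by (rule Lim_transform_eventually)
  with inf show ?thesis by (rule tendsto_unique[OF trivial_limit_at_infinity])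
qed

section \<open>P-symbols and Fuchs's relation\<close>

text \<open>
  The value \<open>0\<close> at infinity is a dummy: only the finite columns \<open>1, \<dots>, n - 1\<close> of a normalized
  P-symbol are meant.
\<close>

definition coord :: "psymbol \<Rightarrow> nat \<Rightarrow> complex" where
  "coord P i = (case point P i of Fin a \<Rightarrow> a | Infty \<Rightarrow> 0)"

lemma point_eq_coord:
  assumes P: "normalized n P" and i: "i \<in> {1..<n}"
  shows "point P i = Fin (coord P i)"
proof -
  have "inj_on (point P) {1..n}" "point P n = Infty"
    using P unfolding normalized_def by auto
  then have "point P i \<noteq> Infty"
    using i inj_onD[of "point P" "{1..n}" i n] by auto
  then show ?thesis unfolding coord_def by (cases "point P i") auto
qed

lemma inj_on_coord:
  assumes "normalized n P"
  shows "inj_on (coord P) {1..<n}"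
proof (rule inj_onI)
  fix i j assume ij: "i \<in> {1..<n}" "j \<in> {1..<n}" and "coord P i = coord P j"
  then have "point P i = point P j" using point_eq_coord[OF assms] by metis
  moreover have "inj_on (point P) {1..n}" using assms unfolding normalized_def by blast
  ultimately show "i = j" using ij by (auto dest: inj_onD)
qed

lemma ordinary_points_eq:
  assumes "normalized n P" "n \<ge> 1"
  shows "{z. Fin z \<notin> point P ` {1..n}} = - (coord P ` {1..<n})"
proof -
  have "{1..n} = insert n {1..<n}" using assms(2) by auto
  moreover have "point P n = Infty" using assms(1) unfolding normalized_def by auto
  ultimately show ?thesis using point_eq_coord[OF assms(1)] by auto
qed

definition fuchs_relation :: "nat \<Rightarrow> psymbol \<Rightarrow> bool" where
  "fuchs_relation n P \<longleftrightarrow> (\<Sum>i\<in>{1..n}. exp1 P i + exp2 P i) = of_nat n - 2"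

lemma fuchs_relation_split:
  assumes "n \<ge> 1"
  shows "fuchs_relation n P \<longleftrightarrow>
    (\<Sum>i\<in>{1..<n}. exp1 P i + exp2 P i) + (exp1 P n + exp2 P n) = of_nat n - 2"
proof -
  have "{1..n} = insert n {1..<n}" using assms by auto
  then show ?thesis unfolding fuchs_relation_def by (simp add: add_ac)
qed

lemma indicial_finite:
  fixes p0 q0 r s :: complex
  assumes "\<forall>\<rho>. \<rho> * (\<rho> - 1) + p0 * \<rho> + q0 = (\<rho> - r) * (\<rho> - s)"
  shows "p0 = 1 - (r + s)"
  using assms[rule_format, of 0] assms[rule_format, of 1] by (simp add: algebra_simps)

lemma indicial_infinite:
  fixes p0 q0 r s :: complex
  assumes "\<forall>\<rho>. \<rho> * (\<rho> + 1) - p0 * \<rho> + q0 = (\<rho> - r) * (\<rho> - s)"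
  shows "p0 = 1 + (r + s)"
proof -
  have "q0 = r * s" "2 - p0 + q0 = (1 - r) * (1 - s)"
    using assms[rule_format, of 0] assms[rule_format, of 1] by auto
  then show ?thesis by (simp add: algebra_simps)
qed

text \<open>
  The indicial polynomials show that \<open>p\<close> has residue \<open>1 - (r + s)\<close> at a finite singular point with
  exponents \<open>r\<close>, \<open>s\<close>, and that \<open>z p(z)\<close> tends to \<open>1 + (\<alpha> + \<beta>)\<close> at infinity.  Equating the latter to
  the sum of the residues is Fuchs's relation.
\<close>

lemma fuchsian_imp_fuchs_relation:
  assumes P: "normalized n P" and "n \<ge> 1" and pq: "fuchsian n p q P"
  shows "fuchs_relation n P"
proof -
  let ?r = "\<lambda>i. 1 - (exp1 P i + exp2 P i)"
  have exps: "has_exponents p q (point P i) (exp1 P i) (exp2 P i)" if "i \<in> {1..n}" for i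
    using pq that unfolding fuchsian_def by blast
  have hol: "p holomorphic_on - (coord P ` {1..<n})"
    using pq ordinary_points_eq[OF P \<open>n \<ge> 1\<close>] unfolding fuchsian_def by simp
  have res: "((\<lambda>z. (z - coord P i) * p z) \<longlongrightarrow> ?r i) (at (coord P i))" if i: "i \<in> {1..<n}" for i
    using exps[of i] point_eq_coord[OF P i] i by (auto dest!: indicial_finite)
  have "has_exponents p q Infty (exp1 P n) (exp2 P n)"
    using exps[of n] P \<open>n \<ge> 1\<close> unfolding normalized_def by auto
  then have "((\<lambda>z. z * p z) \<longlongrightarrow> 1 + (exp1 P n + exp2 P n)) at_infinity"
    by (auto dest!: indicial_infinite)
  with hol res have "1 + (exp1 P n + exp2 P n) = (\<Sum>i\<in>{1..<n}. ?r i)"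
    using inj_on_coord[OF P] by (intro sum_of_residues) auto
  also have "\<dots> = of_nat n - 1 - (\<Sum>i\<in>{1..<n}. exp1 P i + exp2 P i)"
    using \<open>n \<ge> 1\<close> by (simp add: sum_subtractf of_nat_diff)
  finally show ?thesis unfolding fuchs_relation_split[OF \<open>n \<ge> 1\<close>] by (simp add: algebra_simps)
qed

text \<open>
  The coefficient \<open>p\<close> is forced to be the sum of its polar parts, and Fuchs's relation gives it the
  right behaviour at infinity.  For \<open>q\<close> the accessory parameters leave much freedom.  As one exponent
  at each finite point is zero, it suffices that \<open>q\<close> has at most simple poles there and that
  \<open>z\<^sup>2 q(z) \<rightarrow> \<alpha> \<beta>\<close> at infinity; \<open>q = \<alpha> \<beta> / (z (z - 1))\<close> does this with poles at the first two
  columns only.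
\<close>

lemma fuchs_relation_imp_fuchsian:
  assumes P: "normalized n P" and n: "n \<ge> 3" and rel: "fuchs_relation n P"
  shows "\<exists>p q. fuchsian n p q P"
proof -
  define p where "p = (\<lambda>z. \<Sum>i\<in>{1..<n}. (1 - exp2 P i) / (z - coord P i))"
  define c where "c = exp1 P n * exp2 P n"
  define q where "q = (\<lambda>z. c / (z * (z - 1)))"
  have [simp]: "n \<ge> 1" and I: "{1..n} = insert n {1..<n}" using n by auto
  have exp1: "exp1 P i = 0" if "i \<in> {1..<n}" for i
    using P that unfolding normalized_def by auto
  have coords: "coord P 1 = 0" "coord P 2 = 1"
    using P unfolding normalized_def coord_def by auto
  moreover have "1 \<in> {1..<n}" "2 \<in> {1..<n}" using n by auto
  ultimately have mem: "0 \<in> coord P ` {1..<n}" "1 \<in> coord P ` {1..<n}"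
    by (metis image_eqI)+
  have "p holomorphic_on - (coord P ` {1..<n})"
    unfolding p_def by (auto intro!: holomorphic_intros)
  moreover have "q holomorphic_on - (coord P ` {1..<n})"
    unfolding q_def using mem by (auto intro!: holomorphic_intros)
  moreover have "has_exponents p q (Fin (coord P i)) 0 (exp2 P i)" if i: "i \<in> {1..<n}" for i
  proof -
    let ?a = "coord P i"
    have "((\<lambda>z. (z - ?a) * p z) \<longlongrightarrow> 1 - exp2 P i) (at ?a)"
      unfolding p_def by (rule simple_pole_sum_tendsto) (use i inj_on_coord[OF P] in auto)
    moreover have "((\<lambda>z. (z - ?a)\<^sup>2 * q z) \<longlongrightarrow> 0) (at ?a)"
    proof -
      consider "?a = 0" | "?a = 1" | "?a \<noteq> 0" "?a \<noteq> 1" by blast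
      then show ?thesis
      proof cases
        case 1
        have "((\<lambda>z. z * (c / (z - 1))) \<longlongrightarrow> 0 * (c / (0 - 1))) (at (0::complex))"
          by (intro tendsto_intros) auto
        moreover have "\<forall>\<^sub>F z in at 0. z * (c / (z - 1)) = (z - 0)\<^sup>2 * q z"
          unfolding eventually_at_topological q_def
          by (intro exI[of _ UNIV]) (auto simp: power2_eq_square)
        ultimately show ?thesis unfolding 1 by (auto elim: Lim_transform_eventually)
      next
        case 2
        have "((\<lambda>z. (z - 1) * (c / z)) \<longlongrightarrow> (1 - 1) * (c / 1)) (at (1::complex))"
          by (intro tendsto_intros) auto
        moreover have "\<forall>\<^sub>F z in at 1. (z - 1) * (c / z) = (z - 1)\<^sup>2 * q z"
          unfolding eventually_at_topological q_def
          by (intro exI[of _ UNIV]) (auto simp: power2_eq_square)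
        ultimately show ?thesis unfolding 2 by (auto elim: Lim_transform_eventually)
      next
        case 3
        have "((\<lambda>z. (z - ?a)\<^sup>2 * q z) \<longlongrightarrow> (?a - ?a)\<^sup>2 * q ?a) (at ?a)"
          unfolding q_def using 3 by (intro tendsto_intros) auto
        then show ?thesis by simp
      qed
    qed
    moreover have "\<forall>\<rho>. \<rho> * (\<rho> - 1) + (1 - exp2 P i) * \<rho> + 0 = (\<rho> - 0) * (\<rho> - exp2 P i)"
      by (simp add: algebra_simps)
    ultimately show ?thesis unfolding has_exponents.simps by blast
  qed
  moreover have "has_exponents p q Infty (exp1 P n) (exp2 P n)"
  proof -
    have "(\<Sum>i\<in>{1..<n}. 1 - exp2 P i) = 1 + (exp1 P n + exp2 P n)"
      using rel n exp1 unfolding fuchs_relation_split[OF \<open>n \<ge> 1\<close>]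
      by (simp add: sum_subtractf of_nat_diff algebra_simps)
    then have "((\<lambda>z. z * p z) \<longlongrightarrow> 1 + (exp1 P n + exp2 P n)) at_infinity"
      unfolding p_def using simple_pole_sum_tendsto_infinity[of "\<lambda>i. 1 - exp2 P i" "coord P" "{1..<n}"] by simp
    moreover have "((\<lambda>z. z\<^sup>2 * q z) \<longlongrightarrow> c) at_infinity"
    proof -
      \<comment> \<open>\<open>z\<^sup>2 q(z) = z c / (z - 1)\<close> is the case of a single pole at \<open>1\<close>.\<close>
      have "((\<lambda>z. z * (\<Sum>i\<in>{()}. c / (z - 1))) \<longlongrightarrow> (\<Sum>i\<in>{()}. c)) at_infinity"
        by (rule simple_pole_sum_tendsto_infinity)
      moreover have "\<forall>\<^sub>F z in at_infinity. z * (\<Sum>i\<in>{()}. c / (z - 1)) = z\<^sup>2 * q z"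
        using eventually_not_equal_at_infinity[of "0::complex"]
        by eventually_elim (auto simp: q_def power2_eq_square)
      ultimately show ?thesis by (auto elim: Lim_transform_eventually)
    qed
    moreover have "\<forall>\<rho>. \<rho> * (\<rho> + 1) - (1 + (exp1 P n + exp2 P n)) * \<rho> + c =
        (\<rho> - exp1 P n) * (\<rho> - exp2 P n)"
      unfolding c_def by (simp add: algebra_simps)
    ultimately show ?thesis unfolding has_exponents.simps by blast
  qed
  moreover have "point P n = Infty" using P unfolding normalized_def by auto
  ultimately have "fuchsian n p q P"
    unfolding fuchsian_def ordinary_points_eq[OF P \<open>n \<ge> 1\<close>]
    using point_eq_coord[OF P] exp1 unfolding I by auto
  then show ?thesis by blast
qed

lemma psymbols_eq:
  assumes "n \<ge> 3"
  shows "psymbols n = {P \<in> extensional {1..n}. normalized n P \<and> fuchs_relation n P}"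
proof -
  have "n \<ge> 1" using assms by simp
  have "(\<exists>p q. fuchsian n p q P) \<longleftrightarrow> fuchs_relation n P" if P: "normalized n P" for P
    using fuchsian_imp_fuchs_relation[OF P \<open>n \<ge> 1\<close>] fuchs_relation_imp_fuchsian[OF P assms]
    by blast
  then show ?thesis unfolding psymbols_def by blast
qed

text \<open>
  The exponents at infinity are determined because their sum is known from Fuchs's relation and
  their difference is \<open>theta P n\<close>.
\<close>

lemma psymbol_eqI:
  assumes n: "n \<ge> 3" and P: "P \<in> psymbols n" and Q: "Q \<in> psymbols n"
    and eq: "\<And>i. i \<in> {1..n} \<Longrightarrow> point P i = point Q i" "\<And>i. i \<in> {1..n} \<Longrightarrow> theta P i = theta Q i"
  shows "P = Q"
proof (rule extensionalityI[of _ "{1..n}"])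
  show "P \<in> extensional {1..n}" "Q \<in> extensional {1..n}"
    using P Q unfolding psymbols_def by auto
  have fin: "exp1 P i = 0" "exp1 Q i = 0" "exp2 P i = exp2 Q i" if "i \<in> {1..<n}" for i
    using P Q that eq(2)[of i] unfolding psymbols_def normalized_def theta_def by auto
  have "(\<Sum>i\<in>{1..<n}. exp1 P i + exp2 P i) = (\<Sum>i\<in>{1..<n}. exp1 Q i + exp2 Q i)"
    using fin by (intro sum.cong) auto
  moreover have "fuchs_relation n P" "fuchs_relation n Q"
    using P Q unfolding psymbols_eq[OF n] by auto
  moreover have "n \<ge> 1" using n by simp
  ultimately have "exp1 P n + exp2 P n = exp1 Q n + exp2 Q n"
    unfolding fuchs_relation_split[OF \<open>n \<ge> 1\<close>] by (metis add_left_cancel)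
  then have plus: "exp2 P n + exp1 P n = exp2 Q n + exp1 Q n" by (simp add: add.commute)
  have minus: "exp2 P n - exp1 P n = exp2 Q n - exp1 Q n"
    using eq(2)[of n] n unfolding theta_def by simp
  have "2 * exp1 P n = 2 * exp1 Q n"
    using arg_cong2[OF plus minus, of "(-)"] by simp
  then have inf: "exp1 P n = exp1 Q n" "exp2 P n = exp2 Q n" using plus by auto
  fix i assume i: "i \<in> {1..n}"
  then have "exp1 P i = exp1 Q i" "exp2 P i = exp2 Q i"
    using fin[of i] inf by (cases "i = n"; auto)+
  then show "P i = Q i"
    using eq(1)[OF i] unfolding exp1_def exp2_def point_def by (simp add: prod_eq_iff)
qed

text \<open>
  The exponent differences really are free parameters: Fuchs's relation only fixes \<open>\<alpha>\<close>.  Any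
  distinct points will do; here they are \<open>0, 1, \<dots>, n - 2, \<infinity>\<close>.
\<close>

lemma psymbol_with_theta:
  assumes n: "n \<ge> 3"
  obtains P where "P \<in> psymbols n" "\<And>i. i \<in> {1..n} \<Longrightarrow> theta P i = t i"
proof -
  define \<alpha> where "\<alpha> = (of_nat n - 2 - (\<Sum>i\<in>{1..n}. t i)) / 2"
  define P :: psymbol where
    "P = (\<lambda>i\<in>{1..n}. if i < n then (Fin (of_nat (i - 1)), 0, t i) else (Infty, \<alpha>, \<alpha> + t i))"
  have sel: "i \<in> {1..<n} \<Longrightarrow> point P i = Fin (of_nat (i - 1))"
    "i \<in> {1..<n} \<Longrightarrow> exp1 P i = 0" "i \<in> {1..<n} \<Longrightarrow> exp2 P i = t i"
    "point P n = Infty" "exp1 P n = \<alpha>" "exp2 P n = \<alpha> + t n" for i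
    using n unfolding P_def point_def exp1_def exp2_def by auto
  have I: "{1..n} = insert n {1..<n}" using n by auto
  have "inj_on (point P) {1..n}"
  proof (rule inj_onI)
    fix i j assume "i \<in> {1..n}" "j \<in> {1..n}" "point P i = point P j"
    then show "i = j"
      by (cases "i = n"; cases "j = n") (auto simp: sel)
  qed
  moreover have "point P 1 = Fin 0" "point P 2 = Fin 1"
    using n by (auto simp: sel)
  moreover have "fuchs_relation n P"
  proof -
    have "(\<Sum>i\<in>{1..<n}. exp1 P i + exp2 P i) = (\<Sum>i\<in>{1..<n}. t i)"
      by (intro sum.cong) (auto simp: sel)
    moreover have "exp1 P n + exp2 P n = 2 * \<alpha> + t n" by (simp add: sel)
    moreover have "2 * \<alpha> = of_nat n - 2 - ((\<Sum>i\<in>{1..<n}. t i) + t n)"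
      unfolding \<alpha>_def I by (simp add: add.commute)
    moreover have "n \<ge> 1" using n by simp
    ultimately show ?thesis by (simp add: fuchs_relation_split)
  qed
  ultimately have "P \<in> psymbols n"
    unfolding psymbols_eq[OF n] normalized_def using sel by (auto simp: P_def)
  moreover have "theta P i = t i" if "i \<in> {1..n}" for i
    using that unfolding theta_def by (cases "i = n") (auto simp: sel)
  ultimately show thesis using that by blast
qed

section \<open>Action of the generators on P-symbols\<close>

text \<open>
  Since \<open>inv\<close> denotes inversion in a group here, the inverse of a permutation gets a name of its own.
\<close>

abbreviation inv_perm :: "(nat \<Rightarrow> nat) \<Rightarrow> nat \<Rightarrow> nat" where
  "inv_perm \<sigma> \<equiv> inv_into UNIV \<sigma>"


lemma multiply_powers_simps:
  assumes "i \<in> {1..n}"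
  shows "point (multiply_powers n c P) i = point P i"
    and "exp1 (multiply_powers n c P) i = exp1 P i + (if i < n then c i else - (\<Sum>j\<in>{1..<n}. c j))"
    and "exp2 (multiply_powers n c P) i = exp2 P i + (if i < n then c i else - (\<Sum>j\<in>{1..<n}. c j))"
    and "theta (multiply_powers n c P) i = theta P i"
  using assms by (simp_all add: multiply_powers_def point_def exp1_def exp2_def theta_def Let_def)

lemma fuchs_relation_multiply_powers:
  assumes "n \<ge> 1"
  shows "fuchs_relation n (multiply_powers n c P) \<longleftrightarrow> fuchs_relation n P"
proof -
  let ?M = "multiply_powers n c P" and ?C = "\<Sum>j\<in>{1..<n}. c j"
  have "(\<Sum>i\<in>{1..<n}. exp1 ?M i + exp2 ?M i) = (\<Sum>i\<in>{1..<n}. (exp1 P i + exp2 P i) + (c i + c i))"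
    by (intro sum.cong) (auto simp: multiply_powers_simps)
  also have "\<dots> = (\<Sum>i\<in>{1..<n}. exp1 P i + exp2 P i) + (?C + ?C)"
    by (simp only: sum.distrib)
  finally show ?thesis
    using assms by (simp add: fuchs_relation_split multiply_powers_simps)
qed

lemma swap_exponents_simps:
  "point (swap_exponents i P) j = point P j"
  "exp1 (swap_exponents i P) j = (if j = i then exp2 P j else exp1 P j)"
  "exp2 (swap_exponents i P) j = (if j = i then exp1 P j else exp2 P j)"
  "theta (swap_exponents i P) j = (if j = i then - theta P j else theta P j)"
  unfolding swap_exponents_def point_def exp1_def exp2_def theta_def by auto

lemma fuchs_relation_swap_exponents:
  "fuchs_relation n (swap_exponents i P) \<longleftrightarrow> fuchs_relation n P"
proof -
  have "exp1 (swap_exponents i P) j + exp2 (swap_exponents i P) j = exp1 P j + exp2 P j" for j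
    by (simp add: swap_exponents_simps)
  then show ?thesis unfolding fuchs_relation_def by simp
qed

lemma swap_exponents_extensional:
  "i \<in> {1..n} \<Longrightarrow> P \<in> extensional {1..n} \<Longrightarrow> swap_exponents i P \<in> extensional {1..n}"
  unfolding swap_exponents_def extensional_def by auto

lemma normalizedI_point_cong:
  assumes "normalized n P" "n \<ge> 3" "\<And>i. i \<in> {1..n} \<Longrightarrow> point Q i = point P i"
    "\<And>i. i \<in> {1..<n} \<Longrightarrow> exp1 Q i = 0"
  shows "normalized n Q"
  using assms inj_on_cong[of "{1..n}" "point Q" "point P"] unfolding normalized_def by auto

lemma f_homotopy_psymbols:
  assumes n: "n \<ge> 3" and i: "i \<in> {1..n}" and P: "P \<in> psymbols n"
  shows "f_homotopy n i P \<in> psymbols n"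
proof -
  have ext: "P \<in> extensional {1..n}" and norm: "normalized n P" and rel: "fuchs_relation n P"
    using P unfolding psymbols_eq[OF n] by auto
  have exp1: "exp1 P j = 0" if "j \<in> {1..<n}" for j
    using norm that unfolding normalized_def by auto
  let ?F = "f_homotopy n i P"
  have "?F \<in> extensional {1..n}"
    using ext i swap_exponents_extensional[of _ n] unfolding f_homotopy_def multiply_powers_def
    by simp
  moreover have "normalized n ?F"
    using norm n
  proof (rule normalizedI_point_cong)
    show "point ?F j = point P j" if "j \<in> {1..n}" for j
      using that by (simp add: f_homotopy_def swap_exponents_simps multiply_powers_simps)
    show "exp1 ?F j = 0" if "j \<in> {1..<n}" for j
      using that i exp1
      by (auto simp: f_homotopy_def swap_exponents_simps multiply_powers_simps theta_def)
  qed
  moreover have "fuchs_relation n ?F"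
    using rel n
    by (simp add: f_homotopy_def fuchs_relation_swap_exponents fuchs_relation_multiply_powers)
  ultimately show ?thesis unfolding psymbols_eq[OF n] by blast
qed

lemma f_homotopy_acts_by:
  assumes "i \<in> {1..n}"
  shows "acts_by n (f_homotopy n i) id {i}"
proof -
  have "point (f_homotopy n i P) j = point P j"
    "theta (f_homotopy n i P) j = (if j \<in> {i} then - theta P j else theta P j)"
    if "j \<in> {1..n}" for P j
    using that assms by (auto simp: f_homotopy_def swap_exponents_simps multiply_powers_simps)
  then show ?thesis
    unfolding acts_by_def using assms is_moebius_id by (auto intro!: exI[of _ id] permutes_id)
qed

lemma moebius_automorphism_simps:
  fixes n P \<sigma>
  defines "m \<equiv> moebius_to_01inf (point P (inv_perm \<sigma> 1)) (point P (inv_perm \<sigma> 2)) (point P (inv_perm \<sigma> n))"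
  assumes n: "n \<ge> 3" and "i \<in> {1..n}"
  shows "point (moebius_automorphism n \<sigma> P) i = m (point P (inv_perm \<sigma> i))"
    and "i < n \<Longrightarrow> exp1 (moebius_automorphism n \<sigma> P) i = 0"
    and "theta (moebius_automorphism n \<sigma> P) i = theta P (inv_perm \<sigma> i)"
proof -
  let ?Q = "relabel n \<sigma> P"
  let ?R = "move_points n m ?Q"
  have "point ?Q j = point P (inv_perm \<sigma> j)" if "j \<in> {1..n}" for j
    using that by (simp add: relabel_def point_def)
  then have "moebius_to_01inf (point ?Q 1) (point ?Q 2) (point ?Q n) = m"
    using n unfolding m_def by simp
  then have eq: "moebius_automorphism n \<sigma> P = multiply_powers n (\<lambda>j. - exp1 ?R j) ?R"
    unfolding moebius_automorphism_def Let_def by simp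
  have "point ?R i = m (point P (inv_perm \<sigma> i))" "theta ?R i = theta P (inv_perm \<sigma> i)"
    using \<open>i \<in> {1..n}\<close>
    by (simp_all add: move_points_def relabel_def point_def theta_def exp1_def exp2_def)
  then show "point (moebius_automorphism n \<sigma> P) i = m (point P (inv_perm \<sigma> i))"
    "i < n \<Longrightarrow> exp1 (moebius_automorphism n \<sigma> P) i = 0"
    "theta (moebius_automorphism n \<sigma> P) i = theta P (inv_perm \<sigma> i)"
    using \<open>i \<in> {1..n}\<close> unfolding eq by (simp_all add: multiply_powers_simps)
qed

lemma fuchs_relation_moebius_automorphism:
  assumes n: "n \<ge> 1" and \<sigma>: "\<sigma> permutes {1..n}"
  shows "fuchs_relation n (moebius_automorphism n \<sigma> P) \<longleftrightarrow> fuchs_relation n P"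
proof -
  have "fuchs_relation n (move_points n m (relabel n \<sigma> P)) \<longleftrightarrow> fuchs_relation n P" for m
  proof -
    let ?R = "move_points n m (relabel n \<sigma> P)"
    have "(\<Sum>i\<in>{1..n}. exp1 ?R i + exp2 ?R i) = (\<Sum>i\<in>{1..n}. ((\<lambda>i. exp1 P i + exp2 P i) \<circ> inv_perm \<sigma>) i)"
      by (intro sum.cong) (auto simp: move_points_def relabel_def exp1_def exp2_def)
    also have "\<dots> = (\<Sum>i\<in>{1..n}. exp1 P i + exp2 P i)"
      using sum.permute[OF permutes_inv[OF \<sigma>], of "\<lambda>i. exp1 P i + exp2 P i"] by simp
    finally show ?thesis unfolding fuchs_relation_def by simp
  qed
  then show ?thesis
    unfolding moebius_automorphism_def Let_def using fuchs_relation_multiply_powers[OF n] by simp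
qed

text \<open>
  The three columns that receive the labels \<open>1\<close>, \<open>2\<close>, \<open>n\<close> carry distinct points, since the labels are
  distinct and the points of a P-symbol are; hence the normalizing Moebius transformation exists.
\<close>

lemma moebius_automorphism_moebius:
  assumes n: "n \<ge> 3" and \<sigma>: "\<sigma> permutes {1..n}" and P: "P \<in> psymbols n"
  shows "\<exists>m. is_moebius m \<and> m (point P (inv_perm \<sigma> 1)) = Fin 0 \<and> m (point P (inv_perm \<sigma> 2)) = Fin 1 \<and>
    m (point P (inv_perm \<sigma> n)) = Infty \<and>
    (\<forall>i\<in>{1..n}. point (moebius_automorphism n \<sigma> P) i = m (point P (inv_perm \<sigma> i)))"
proof -
  let ?u = "\<lambda>i. point P (inv_perm \<sigma> i)"
  have "inj_on (point P) {1..n}" using P unfolding psymbols_def normalized_def by auto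
  then have "inj_on (point P \<circ> inv_perm \<sigma>) {1..n}"
    using permutes_inv[OF \<sigma>] by (intro comp_inj_on) (auto simp: permutes_inj_on permutes_image)
  then have "?u i \<noteq> ?u j" if "i \<noteq> j" "i \<in> {1..n}" "j \<in> {1..n}" for i j
    using that inj_onD[of "point P \<circ> inv_perm \<sigma>" "{1..n}" i j] by auto
  then have "?u 1 \<noteq> ?u 2" "?u 1 \<noteq> ?u n" "?u 2 \<noteq> ?u n" using n by simp_all
  from moebius_to_01inf[OF this] show ?thesis
    using moebius_automorphism_simps(1)[OF n] by blast
qed

lemma moebius_automorphism_psymbols:
  assumes n: "n \<ge> 3" and \<sigma>: "\<sigma> permutes {1..n}" and P: "P \<in> psymbols n"
  shows "moebius_automorphism n \<sigma> P \<in> psymbols n"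
proof -
  let ?M = "moebius_automorphism n \<sigma> P"
  obtain m where m: "is_moebius m" "m (point P (inv_perm \<sigma> 1)) = Fin 0" "m (point P (inv_perm \<sigma> 2)) = Fin 1"
    "m (point P (inv_perm \<sigma> n)) = Infty" "\<And>i. i \<in> {1..n} \<Longrightarrow> point ?M i = m (point P (inv_perm \<sigma> i))"
    using moebius_automorphism_moebius[OF assms] by blast
  have "inj_on (point P) {1..n}" using P unfolding psymbols_def normalized_def by auto
  then have "inj_on (m \<circ> (point P \<circ> inv_perm \<sigma>)) {1..n}"
    using permutes_inv[OF \<sigma>] is_moebius_inj[OF m(1)]
    by (intro comp_inj_on) (auto simp: permutes_inj_on permutes_image intro: inj_on_subset)
  moreover have "inj_on (point ?M) {1..n} = inj_on (m \<circ> (point P \<circ> inv_perm \<sigma>)) {1..n}"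
    by (rule inj_on_cong) (simp add: m(5))
  ultimately have "normalized n ?M"
    unfolding normalized_def using m n moebius_automorphism_simps(2)[OF n] by auto
  moreover have "?M \<in> extensional {1..n}"
    unfolding moebius_automorphism_def multiply_powers_def Let_def by simp
  moreover have "fuchs_relation n ?M"
    using fuchs_relation_moebius_automorphism[OF _ \<sigma>] P n unfolding psymbols_eq[OF n] by simp
  ultimately show ?thesis unfolding psymbols_eq[OF n] by blast
qed

lemma moebius_automorphism_acts_by:
  assumes n: "n \<ge> 3" and \<sigma>: "\<sigma> permutes {1..n}"
  shows "acts_by n (moebius_automorphism n \<sigma>) \<sigma> {}"
proof -
  have inv: "inv_perm \<sigma> (\<sigma> j) = j" "\<sigma> j \<in> {1..n} \<longleftrightarrow> j \<in> {1..n}" for j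
    using permutes_inverses(2)[OF \<sigma>] permutes_in_image[OF \<sigma>] by auto
  show ?thesis
    unfolding acts_by_def
  proof (intro conjI ballI)
    fix P assume "P \<in> psymbols n"
    then obtain m where m: "is_moebius m"
      "\<And>i. i \<in> {1..n} \<Longrightarrow> point (moebius_automorphism n \<sigma> P) i = m (point P (inv_perm \<sigma> i))"
      using moebius_automorphism_moebius[OF assms] by blast
    then show "\<exists>m. is_moebius m \<and>
        (\<forall>j\<in>{1..n}. point (moebius_automorphism n \<sigma> P) (\<sigma> j) = m (point P j))"
      using inv by (intro exI[of _ m]) simp
  next
    fix P j assume "j \<in> {1..n}"
    then show "theta (moebius_automorphism n \<sigma> P) (\<sigma> j) =
        (if \<sigma> j \<in> {} then - theta P j else theta P j)"
      using moebius_automorphism_simps(3)[OF n, of "\<sigma> j"] inv by simp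
  qed (use \<sigma> in auto)
qed

section \<open>Automorphisms as signed permutations\<close>

lemma acts_by_restrict: "acts_by n (restrict g (psymbols n)) \<sigma> N \<longleftrightarrow> acts_by n g \<sigma> N"
  unfolding acts_by_def by simp

text \<open>
  A signed permutation prescribes the new exponent differences outright and the new points up to a
  Moebius transformation.  Normalization says which three points go to \<open>0\<close>, \<open>1\<close>, \<open>\<infinity>\<close>, so this
  transformation is unique, and a P-symbol is determined by its points and exponent differences.
\<close>

lemma acts_by_determines:
  assumes n: "n \<ge> 3" and g: "acts_by n g \<sigma> N" and h: "acts_by n h \<sigma> N"
    and P: "P \<in> psymbols n" "g P \<in> psymbols n" "h P \<in> psymbols n"
  shows "g P = h P"
proof -
  have \<sigma>: "\<sigma> permutes {1..n}" using g unfolding acts_by_def by blast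
  have inv: "\<sigma> (inv_perm \<sigma> i) = i" "inv_perm \<sigma> i \<in> {1..n} \<longleftrightarrow> i \<in> {1..n}" for i
    using permutes_inverses(1)[OF \<sigma>] permutes_in_image[OF permutes_inv[OF \<sigma>]] by auto
  obtain m where m: "is_moebius m" "\<forall>j\<in>{1..n}. point (g P) (\<sigma> j) = m (point P j)"
    using g P(1) unfolding acts_by_def by blast
  obtain k where k: "is_moebius k" "\<forall>j\<in>{1..n}. point (h P) (\<sigma> j) = k (point P j)"
    using h P(1) unfolding acts_by_def by blast
  have pts: "point (g P) i = m (point P (inv_perm \<sigma> i))" "point (h P) i = k (point P (inv_perm \<sigma> i))"
    if "i \<in> {1..n}" for i
    using m(2) k(2) inv that by metis+
  have "normalized n (g P)" "normalized n (h P)" using P unfolding psymbols_def by auto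
  then have "m = k"
    using pts[of 1] pts[of 2] pts[of n] n m(1) k(1) unfolding normalized_def
    by (intro moebius_unique[of m "point P (inv_perm \<sigma> 1)" "point P (inv_perm \<sigma> 2)" "point P (inv_perm \<sigma> n)" k]) auto
  moreover have "theta (g P) i = theta (h P) i" if "i \<in> {1..n}" for i
    using g h P(1) inv that unfolding acts_by_def by metis
  ultimately show ?thesis using pts by (intro psymbol_eqI[OF n P(2,3)]) auto
qed

text \<open>
  On a P-symbol with \<open>\<theta>\<^sub>i = i\<close> the exponent differences are nonzero and distinct up to sign.
  The image therefore shows where each column has gone and whether it was negated.
\<close>

lemma acts_by_unique:
  assumes n: "n \<ge> 3" and g: "acts_by n g \<sigma> N" "acts_by n g \<tau> M"
  shows "\<sigma> = \<tau> \<and> N = M"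
proof -
  obtain P where P: "P \<in> psymbols n" "\<And>i. i \<in> {1..n} \<Longrightarrow> theta P i = of_nat i"
    using psymbol_with_theta[OF n, where t = of_nat] by blast
  have \<sigma>: "\<sigma> permutes {1..n}" and \<tau>: "\<tau> permutes {1..n}" and "N \<subseteq> {1..n}" "M \<subseteq> {1..n}"
    using g unfolding acts_by_def by auto
  have \<theta>\<sigma>: "theta (g P) (\<sigma> j) = (if \<sigma> j \<in> N then - of_nat j else of_nat j)"
    and \<theta>\<tau>: "theta (g P) (\<tau> j) = (if \<tau> j \<in> M then - of_nat j else of_nat j)" if "j \<in> {1..n}" for j
    using g P that unfolding acts_by_def by auto
  have same: "\<sigma> j = \<tau> j \<and> (\<sigma> j \<in> N \<longleftrightarrow> \<sigma> j \<in> M)" if j: "j \<in> {1..n}" for j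
  proof -
    define k where "k = inv_perm \<tau> (\<sigma> j)"
    have k: "\<tau> k = \<sigma> j" "k \<in> {1..n}"
      using j \<sigma> \<tau> unfolding k_def
      by (simp_all only: permutes_inverses permutes_in_image permutes_inv)
    \<comment> \<open>The exponent difference found at the label \<open>\<sigma> j = \<tau> k\<close>, read in two ways.\<close>
    have "(if \<sigma> j \<in> N then - of_nat j else of_nat j :: complex) =
        (if \<sigma> j \<in> M then - of_nat k else of_nat k)"
      using \<theta>\<sigma>[OF j] \<theta>\<tau>[OF k(2)] k(1) by simp
    then have "(if \<sigma> j \<in> N then - of_nat j else of_nat j :: real) =
        (if \<sigma> j \<in> M then - of_nat k else of_nat k)"
      by (auto split: if_splits dest: arg_cong[where f = Re])
    then have "j = k \<and> (\<sigma> j \<in> N \<longleftrightarrow> \<sigma> j \<in> M)"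
      using j k(2) by (auto split: if_splits)
    then show ?thesis using k(1) by metis
  qed
  have "\<sigma> = \<tau>"
  proof
    fix j show "\<sigma> j = \<tau> j"
      using same[of j] \<sigma> \<tau> by (cases "j \<in> {1..n}") (auto simp: permutes_not_in)
  qed
  moreover have "i \<in> N \<longleftrightarrow> i \<in> M" if "i \<in> {1..n}" for i
    using same[of "inv_perm \<sigma> i"] that permutes_in_image[OF permutes_inv[OF \<sigma>], of i]
      permutes_inverses(1)[OF \<sigma>, of i]
    by simp
  ultimately show ?thesis using \<open>N \<subseteq> {1..n}\<close> \<open>M \<subseteq> {1..n}\<close> by blast
qed

lemma acts_by_id: "acts_by n (\<lambda>P\<in>psymbols n. P) id {}"
  unfolding acts_by_def using is_moebius_id by (auto intro!: exI[of _ id] permutes_id)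

text \<open>
  The negations \<open>M\<close> of the inner map are carried to the labels \<open>\<sigma> ` M\<close> by the outer one, and two
  negations of the same column cancel; hence the symmetric difference.
\<close>

lemma acts_by_compose:
  assumes g: "acts_by n g \<sigma> N" and h: "acts_by n h \<tau> M"
    and hP: "\<And>P. P \<in> psymbols n \<Longrightarrow> h P \<in> psymbols n"
  shows "acts_by n (compose (psymbols n) g h) (\<sigma> \<circ> \<tau>) ((N - \<sigma> ` M) \<union> (\<sigma> ` M - N))"
proof -
  have \<sigma>: "\<sigma> permutes {1..n}" and \<tau>: "\<tau> permutes {1..n}" and NM: "N \<subseteq> {1..n}" "M \<subseteq> {1..n}"
    using g h unfolding acts_by_def by auto
  have "\<sigma> ` M \<subseteq> {1..n}" using NM(2) permutes_image[OF \<sigma>] by blast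
  moreover have mem: "\<sigma> j \<in> \<sigma> ` M \<longleftrightarrow> j \<in> M" for j
    using permutes_inj[OF \<sigma>] by (auto dest: injD)
  have \<tau>j: "\<tau> j \<in> {1..n}" if "j \<in> {1..n}" for j using permutes_in_image[OF \<tau>] that by auto
  have "\<exists>m. is_moebius m \<and> (\<forall>j\<in>{1..n}. point (g (h P)) (\<sigma> (\<tau> j)) = m (point P j))"
    if P: "P \<in> psymbols n" for P
  proof -
    obtain m where m: "is_moebius m" "\<forall>j\<in>{1..n}. point (g (h P)) (\<sigma> j) = m (point (h P) j)"
      using g hP[OF P] unfolding acts_by_def by blast
    obtain k where k: "is_moebius k" "\<forall>j\<in>{1..n}. point (h P) (\<tau> j) = k (point P j)"
      using h P unfolding acts_by_def by blast
    show ?thesis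
      using is_moebius_comp[OF m(1) k(1)] m(2) k(2) \<tau>j by (intro exI[of _ "m \<circ> k"]) auto
  qed
  moreover have "theta (g (h P)) (\<sigma> (\<tau> j)) =
      (if \<sigma> (\<tau> j) \<in> (N - \<sigma> ` M) \<union> (\<sigma> ` M - N) then - theta P j else theta P j)"
    if P: "P \<in> psymbols n" and j: "j \<in> {1..n}" for P j
  proof -
    have "theta (g (h P)) (\<sigma> (\<tau> j)) =
        (if \<sigma> (\<tau> j) \<in> N then - theta (h P) (\<tau> j) else theta (h P) (\<tau> j))"
      using g hP[OF P] \<tau>j[OF j] unfolding acts_by_def by blast
    moreover have "theta (h P) (\<tau> j) = (if \<tau> j \<in> M then - theta P j else theta P j)"
      using h P j unfolding acts_by_def by blast
    ultimately show ?thesis using mem[of "\<tau> j"] by auto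
  qed
  ultimately show ?thesis
    unfolding acts_by_def using permutes_compose[OF \<tau> \<sigma>] NM(1) by (auto simp: compose_def)
qed

lemma acts_by_inverse:
  assumes g: "acts_by n g \<sigma> N"
    and h: "\<And>P. P \<in> psymbols n \<Longrightarrow> h P \<in> psymbols n \<and> g (h P) = P"
  shows "acts_by n h (inv_perm \<sigma>) (inv_perm \<sigma> ` N)"
proof -
  have \<sigma>: "\<sigma> permutes {1..n}" and N: "N \<subseteq> {1..n}" using g unfolding acts_by_def by auto
  note \<sigma>' = permutes_inv[OF \<sigma>]
  have inv: "\<sigma> (inv_perm \<sigma> i) = i" "inv_perm \<sigma> i \<in> {1..n} \<longleftrightarrow> i \<in> {1..n}" for i
    using permutes_inverses(1)[OF \<sigma>] permutes_in_image[OF \<sigma>'] by auto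
  have mem: "inv_perm \<sigma> i \<in> inv_perm \<sigma> ` N \<longleftrightarrow> i \<in> N" for i
    using permutes_inj[OF \<sigma>'] by (auto dest: injD)
  have "inv_perm \<sigma> ` N \<subseteq> {1..n}" using N permutes_image[OF \<sigma>'] by blast
  moreover have "\<exists>k. is_moebius k \<and> (\<forall>i\<in>{1..n}. point (h P) (inv_perm \<sigma> i) = k (point P i))"
    if P: "P \<in> psymbols n" for P
  proof -
    obtain m where m: "is_moebius m" "\<forall>j\<in>{1..n}. point (g (h P)) (\<sigma> j) = m (point (h P) j)"
      using g h[OF P] unfolding acts_by_def by blast
    obtain k where k: "is_moebius k" "k \<circ> m = id" using is_moebius_inverse[OF m(1)] .
    have "point P i = m (point (h P) (inv_perm \<sigma> i))" if "i \<in> {1..n}" for i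
      using m(2) h[OF P] inv[of i] that by metis
    then show ?thesis using k pointfree_idE[OF k(2)] by auto
  qed
  moreover have "theta (h P) (inv_perm \<sigma> i) = (if inv_perm \<sigma> i \<in> inv_perm \<sigma> ` N then - theta P i else theta P i)"
    if P: "P \<in> psymbols n" and i: "i \<in> {1..n}" for P i
  proof -
    have "theta (g (h P)) (\<sigma> (inv_perm \<sigma> i)) =
        (if \<sigma> (inv_perm \<sigma> i) \<in> N then - theta (h P) (inv_perm \<sigma> i) else theta (h P) (inv_perm \<sigma> i))"
      using g h[OF P] inv[of i] i unfolding acts_by_def by blast
    then show ?thesis using h[OF P] mem[of i] inv[of i] by (auto split: if_splits)
  qed
  ultimately show ?thesis unfolding acts_by_def using \<sigma>' by blast
qed

text \<open>
  Both composites act by the trivial signed permutation, so both are the identity.  This yields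
  bijectivity of the generators without computing any composite on P-symbols.
\<close>

lemma acts_by_mutually_inverse_Bij:
  assumes n: "n \<ge> 3" and g: "acts_by n g \<sigma> N" "\<And>P. P \<in> psymbols n \<Longrightarrow> g P \<in> psymbols n"
    and h: "acts_by n h (inv_perm \<sigma>) (inv_perm \<sigma> ` N)" "\<And>P. P \<in> psymbols n \<Longrightarrow> h P \<in> psymbols n"
  shows "restrict g (psymbols n) \<in> Bij (psymbols n)"
proof -
  have \<sigma>: "\<sigma> permutes {1..n}" using g unfolding acts_by_def by auto
  have "inv_perm \<sigma> \<circ> \<sigma> = id" "\<sigma> \<circ> inv_perm \<sigma> = id" "\<sigma> ` inv_perm \<sigma> ` N = N"
    using permutes_inv_o[OF \<sigma>] permutes_inverses(1)[OF \<sigma>] by (auto simp: image_image)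
  then have "acts_by n (compose (psymbols n) h g) id {}" "acts_by n (compose (psymbols n) g h) id {}"
    using acts_by_compose[OF h(1) g] acts_by_compose[OF g(1) h] by auto
  then have "h (g P) = P" "g (h P) = P" if "P \<in> psymbols n" for P
    using acts_by_determines[OF n _ acts_by_id, of "compose (psymbols n) h g" P]
      acts_by_determines[OF n _ acts_by_id, of "compose (psymbols n) g h" P] g(2) h(2) that
    by (simp_all add: compose_eq)
  then have "bij_betw g (psymbols n) (psymbols n)"
    using g(2) h(2) by (intro bij_betw_byWitness[where f' = h]) auto
  moreover have "bij_betw (restrict g (psymbols n)) (psymbols n) (psymbols n) =
      bij_betw g (psymbols n) (psymbols n)"
    by (rule bij_betw_cong) simp
  ultimately show ?thesis unfolding Bij_def by simp
qed

section \<open>The group generated by the F-homotopies and Moebius automorphisms\<close>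

lemma generators_bij_acts_by:
  assumes n: "n \<ge> 3" and g: "g \<in> generators n"
  shows "g \<in> Bij (psymbols n)" "\<exists>\<sigma> N. acts_by n g \<sigma> N"
proof -
  consider i where "i \<in> {1..n}" "g = restrict (f_homotopy n i) (psymbols n)"
    | \<sigma> where "\<sigma> permutes {1..n}" "g = restrict (moebius_automorphism n \<sigma>) (psymbols n)"
    using g unfolding generators_def by blast
  then have "g \<in> Bij (psymbols n) \<and> (\<exists>\<sigma> N. acts_by n g \<sigma> N)"
  proof cases
    case 1
    note act = f_homotopy_acts_by[OF 1(1)] and closed = f_homotopy_psymbols[OF n 1(1)]
    have act_inv: "acts_by n (f_homotopy n i) (inv_perm id) (inv_perm id ` {i})"
      using act by (simp add: inv_id)
    have "g \<in> Bij (psymbols n)"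
      unfolding 1(2) by (intro acts_by_mutually_inverse_Bij[OF n act _ act_inv] closed)
    then show ?thesis unfolding 1(2) acts_by_restrict using act by blast
  next
    case 2
    note \<sigma>' = permutes_inv[OF 2(1)]
    note act = moebius_automorphism_acts_by[OF n 2(1)]
    have act_inv: "acts_by n (moebius_automorphism n (inv_perm \<sigma>)) (inv_perm \<sigma>) (inv_perm \<sigma> ` {})"
      using moebius_automorphism_acts_by[OF n \<sigma>'] by simp
    have "g \<in> Bij (psymbols n)"
      unfolding 2(2)
      by (intro acts_by_mutually_inverse_Bij[OF n act _ act_inv] moebius_automorphism_psymbols[OF n]
          2(1) \<sigma>')
    then show ?thesis unfolding 2(2) acts_by_restrict using act by blast
  qed
  then show "g \<in> Bij (psymbols n)" "\<exists>\<sigma> N. acts_by n g \<sigma> N" by blast+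
qed

lemma Bij_closed: "g \<in> Bij S \<Longrightarrow> x \<in> S \<Longrightarrow> g x \<in> S"
  using Bij_imp_funcset by blast

lemma mult_BijGroup: "g \<in> Bij S \<Longrightarrow> h \<in> Bij S \<Longrightarrow> g \<otimes>\<^bsub>BijGroup S\<^esub> h = compose S g h"
  unfolding BijGroup_def by simp

lemma acts_by_inv_BijGroup:
  assumes g: "acts_by n g \<sigma> N" "g \<in> Bij (psymbols n)"
  shows "acts_by n (inv\<^bsub>BijGroup (psymbols n)\<^esub> g) (inv_perm \<sigma>) (inv_perm \<sigma> ` N)"
proof (rule acts_by_inverse[OF g(1)])
  fix P assume P: "P \<in> psymbols n"
  then have "P \<in> g ` psymbols n" using g(2) unfolding Bij_def bij_betw_def by auto
  then show "(inv\<^bsub>BijGroup (psymbols n)\<^esub> g) P \<in> psymbols n \<and> g ((inv\<^bsub>BijGroup (psymbols n)\<^esub> g) P) = P"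
    using P by (simp add: inv_BijGroup[OF g(2)] inv_into_into f_inv_into_f)
qed

lemma generate_generators_acts_by:
  assumes n: "n \<ge> 3" and g: "g \<in> generate (BijGroup (psymbols n)) (generators n)"
  shows "g \<in> Bij (psymbols n) \<and> (\<exists>\<sigma> N. acts_by n g \<sigma> N)"
proof -
  let ?G = "BijGroup (psymbols n)"
  interpret group ?G by (rule group_BijGroup)
  have carrier: "carrier ?G = Bij (psymbols n)" unfolding BijGroup_def by simp
  note gen = generators_bij_acts_by[OF n]
  show ?thesis using g
  proof (induction rule: generate.induct)
    case one
    have "\<one>\<^bsub>?G\<^esub> = (\<lambda>P\<in>psymbols n. P)" unfolding BijGroup_def by simp
    then show ?case using acts_by_id[of n] one_closed carrier by metis
  next
    case (incl h)
    then show ?case using gen by blast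
  next
    case (inv h)
    then obtain \<sigma> N where "acts_by n h \<sigma> N" using gen by blast
    then have "acts_by n (inv\<^bsub>?G\<^esub> h) (inv_perm \<sigma>) (inv_perm \<sigma> ` N)"
      using gen(1)[OF inv] by (rule acts_by_inv_BijGroup)
    moreover have "inv\<^bsub>?G\<^esub> h \<in> Bij (psymbols n)"
      using inv_closed[of h] gen(1)[OF inv] carrier by blast
    ultimately show ?case by blast
  next
    case (eng g h)
    then obtain \<sigma> N \<tau> M where gh: "acts_by n g \<sigma> N" "acts_by n h \<tau> M" by blast
    from acts_by_compose[OF this] eng.IH
    have "acts_by n (g \<otimes>\<^bsub>?G\<^esub> h) (\<sigma> \<circ> \<tau>) ((N - \<sigma> ` M) \<union> (\<sigma> ` M - N))"
      by (simp add: mult_BijGroup Bij_closed)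
    moreover have "g \<otimes>\<^bsub>?G\<^esub> h \<in> Bij (psymbols n)"
      using m_closed[of g h] eng.IH carrier by blast
    ultimately show ?case by blast
  qed
qed

text \<open>
  First permute with a Moebius automorphism, then negate the columns of \<open>N\<close> one by one with
  F-homotopies.
\<close>

lemma generate_generators_realizes:
  assumes n: "n \<ge> 3" and \<sigma>: "\<sigma> permutes {1..n}" and N: "N \<subseteq> {1..n}"
  shows "\<exists>g \<in> generate (BijGroup (psymbols n)) (generators n). acts_by n g \<sigma> N"
proof -
  let ?G = "BijGroup (psymbols n)"
  have "finite N" using N finite_subset by blast
  then show ?thesis using N
  proof (induction rule: finite_induct)
    case empty
    have "restrict (moebius_automorphism n \<sigma>) (psymbols n) \<in> generators n"
      using \<sigma> unfolding generators_def by blast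
    then show ?case
      using moebius_automorphism_acts_by[OF n \<sigma>] acts_by_restrict generate.incl by metis
  next
    case (insert i N)
    let ?f = "restrict (f_homotopy n i) (psymbols n)"
    obtain g where g: "g \<in> generate ?G (generators n)" "acts_by n g \<sigma> N"
      using insert by auto
    have i: "i \<in> {1..n}" using insert.prems by simp
    then have f: "?f \<in> generators n" unfolding generators_def by blast
    have act: "acts_by n ?f id {i}" using f_homotopy_acts_by[OF i] by (simp only: acts_by_restrict)
    have bij: "g \<in> Bij (psymbols n)" using generate_generators_acts_by[OF n g(1)] by blast
    from acts_by_compose[OF act g(2) Bij_closed[OF bij]]
    have "acts_by n (compose (psymbols n) ?f g) \<sigma> (insert i N)"
      using insert.hyps(2) by (simp add: insert_Diff_if Un_commute)
    then have "acts_by n (?f \<otimes>\<^bsub>?G\<^esub> g) \<sigma> (insert i N)"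
      by (simp only: mult_BijGroup[OF generators_bij_acts_by(1)[OF n f] bij])
    moreover have "?f \<otimes>\<^bsub>?G\<^esub> g \<in> generate ?G (generators n)"
      using generate.eng[OF generate.incl[OF f] g(1)] .
    ultimately show ?case by blast
  qed
qed

lemma automorphism_determined:
  assumes n: "n \<ge> 3" and "acts_by n g \<sigma> N" "acts_by n h \<sigma> N"
    and bij: "g \<in> Bij (psymbols n)" "h \<in> Bij (psymbols n)"
  shows "g = h"
proof (rule extensionalityI[of _ "psymbols n"])
  show "g \<in> extensional (psymbols n)" "h \<in> extensional (psymbols n)"
    using bij by (simp_all add: Bij_imp_extensional)
  show "g P = h P" if "P \<in> psymbols n" for P
    using acts_by_determines[OF n assms(2,3) that] Bij_closed[OF _ that] bij by blast
qed

lemma automorphism_closed_Bij: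
  "n \<ge> 3 \<Longrightarrow> g \<in> carrier (automorphism_group n) \<Longrightarrow> g \<in> Bij (psymbols n)"
  using generate_generators_acts_by unfolding automorphism_group_def by simp

section \<open>Isomorphism with the signed permutations\<close>

text \<open>
  The sign vector records at position \<open>i\<close> whether the column whose new label is \<open>i\<close> is negated; this
  matches the multiplication of the wreath product, where the permutation acts first.
\<close>

definition signed_perm_of :: "nat \<Rightarrow> (psymbol \<Rightarrow> psymbol) \<Rightarrow> (nat \<Rightarrow> int) \<times> (nat \<Rightarrow> nat)" where
  "signed_perm_of n g =
     (THE x. \<exists>\<sigma> N. acts_by n g \<sigma> N \<and> x = (\<lambda>i\<in>{1..n}. of_bool (i \<in> N), \<sigma>))"

lemma signed_perm_of_eq:
  assumes "n \<ge> 3" "acts_by n g \<sigma> N"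
  shows "signed_perm_of n g = (\<lambda>i\<in>{1..n}. of_bool (i \<in> N), \<sigma>)"
  unfolding signed_perm_of_def
  using assms acts_by_unique[OF assms(1)] by (intro the_equality) blast+

lemma carrier_signed_perms:
  "(e, \<sigma>) \<in> carrier (signed_perms m) \<longleftrightarrow>
     e \<in> extensional {1..m} \<and> (\<forall>i\<in>{1..m}. e i = 0 \<or> e i = 1) \<and> \<sigma> permutes {1..m}"
proof -
  have "carrier (integer_mod_group 2) = {0, 1 :: int}"
    unfolding carrier_integer_mod_group by auto
  then show ?thesis
    unfolding signed_perms_def wreath_sym_def by (auto simp: PiE_iff)
qed

lemma mult_signed_perms:
  "(e, \<sigma>) \<otimes>\<^bsub>signed_perms m\<^esub> (d, \<tau>) =
     (\<lambda>i\<in>{1..m}. (e i + d (inv_perm \<sigma> i)) mod 2, \<sigma> \<circ> \<tau>)"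
  unfolding signed_perms_def wreath_sym_def by (simp add: mult_integer_mod_group)

text \<open>
  Composition of automorphisms was computed above: its symmetric difference of negation sets is
  addition of sign vectors modulo 2.  Injectivity holds because an automorphism is determined
  by its signed permutation, surjectivity because all signed permutations are realized.
\<close>

lemma signed_perm_of_iso:
  assumes n: "n \<ge> 3"
  shows "signed_perm_of n \<in> iso (automorphism_group n) (signed_perms n)"
proof -
  let ?A = "automorphism_group n"
  note eq = signed_perm_of_eq[OF n]
  have acts: "\<exists>\<sigma> N. acts_by n g \<sigma> N" if "g \<in> carrier ?A" for g
    using generate_generators_acts_by[OF n, of g] that unfolding automorphism_group_def by simp
  note Bij = automorphism_closed_Bij[OF n]
  have into: "signed_perm_of n g \<in> carrier (signed_perms n)" if g: "g \<in> carrier ?A" for g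
  proof -
    obtain \<sigma> N where act: "acts_by n g \<sigma> N" using acts[OF g] by blast
    then have "\<sigma> permutes {1..n}" unfolding acts_by_def by blast
    then show ?thesis unfolding eq[OF act] carrier_signed_perms by auto
  qed
  have "signed_perm_of n (g \<otimes>\<^bsub>?A\<^esub> h) = signed_perm_of n g \<otimes>\<^bsub>signed_perms n\<^esub> signed_perm_of n h"
    if gh: "g \<in> carrier ?A" "h \<in> carrier ?A" for g h
  proof -
    obtain \<sigma> N where g: "acts_by n g \<sigma> N" using acts[OF gh(1)] by blast
    obtain \<tau> M where h: "acts_by n h \<tau> M" using acts[OF gh(2)] by blast
    have \<sigma>: "\<sigma> permutes {1..n}" using g unfolding acts_by_def by blast
    have "acts_by n (g \<otimes>\<^bsub>?A\<^esub> h) (\<sigma> \<circ> \<tau>) ((N - \<sigma> ` M) \<union> (\<sigma> ` M - N))"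
      using acts_by_compose[OF g h Bij_closed[OF Bij[OF gh(2)]]] Bij gh
      unfolding automorphism_group_def by (simp add: mult_BijGroup)
    moreover have "i \<in> \<sigma> ` M \<longleftrightarrow> inv_perm \<sigma> i \<in> M" for i
      using permutes_inverses[OF \<sigma>] by (metis imageE image_eqI)
    moreover have "inv_perm \<sigma> i \<in> {1..n}" if "i \<in> {1..n}" for i
      using permutes_in_image[OF permutes_inv[OF \<sigma>]] that by blast
    ultimately show ?thesis
      unfolding eq[OF g] eq[OF h] mult_signed_perms by (auto simp: eq restrict_def fun_eq_iff)
  qed
  then have "signed_perm_of n \<in> hom ?A (signed_perms n)"
    using into by (auto simp: hom_def)
  moreover have "inj_on (signed_perm_of n) (carrier ?A)"
  proof (rule inj_onI)
    fix g h assume gh: "g \<in> carrier ?A" "h \<in> carrier ?A" "signed_perm_of n g = signed_perm_of n h"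
    obtain \<sigma> N where g: "acts_by n g \<sigma> N" using acts[OF gh(1)] by blast
    obtain \<tau> M where h: "acts_by n h \<tau> M" using acts[OF gh(2)] by blast
    have "\<sigma> = \<tau>" and signs: "(\<lambda>i\<in>{1..n}. of_bool (i \<in> N) :: int) = (\<lambda>i\<in>{1..n}. of_bool (i \<in> M))"
      using gh(3) unfolding eq[OF g] eq[OF h] by auto
    have "i \<in> N \<longleftrightarrow> i \<in> M" if "i \<in> {1..n}" for i
      using fun_cong[OF signs, of i] that by (auto split: if_splits simp: of_bool_def)
    moreover have "N \<subseteq> {1..n}" "M \<subseteq> {1..n}" using g h unfolding acts_by_def by auto
    ultimately have "N = M" by blast
    then show "g = h"
      using automorphism_determined[OF n g] h Bij gh(1,2) \<open>\<sigma> = \<tau>\<close> by blast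
  qed
  moreover have "carrier (signed_perms n) \<subseteq> signed_perm_of n ` carrier ?A"
  proof
    fix x assume x: "x \<in> carrier (signed_perms n)"
    obtain e \<sigma> where [simp]: "x = (e, \<sigma>)" by (cases x)
    let ?N = "{i \<in> {1..n}. e i = 1}"
    have "\<sigma> permutes {1..n}" "?N \<subseteq> {1..n}" using x by (auto simp: carrier_signed_perms)
    then obtain g where g: "g \<in> carrier ?A" "acts_by n g \<sigma> ?N"
      using generate_generators_realizes[OF n, of \<sigma> ?N] unfolding automorphism_group_def by auto
    have "(\<lambda>i\<in>{1..n}. of_bool (i \<in> ?N)) = e"
      using x by (auto simp: carrier_signed_perms fun_eq_iff extensional_def)
    then show "x \<in> signed_perm_of n ` carrier ?A"
      using g(1) eq[OF g(2)] by (intro image_eqI[of _ _ g]) auto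
  qed
  ultimately show ?thesis using into unfolding iso_def bij_betw_def by auto
qed

text \<open>
  The three remaining groups are cut out of the automorphism group by conditions on the signed
  permutation.  This is what transports such a condition through an isomorphism.
\<close>

lemma iso_restrict_carriers:
  assumes h: "h \<in> iso G H" and A: "A \<subseteq> carrier G" and B: "B \<subseteq> carrier H"
    and AB: "\<And>g. g \<in> carrier G \<Longrightarrow> g \<in> A \<longleftrightarrow> h g \<in> B"
  shows "h \<in> iso (G\<lparr>carrier := A\<rparr>) (H\<lparr>carrier := B\<rparr>)"
proof -
  have hom: "h \<in> hom G H" and bij: "bij_betw h (carrier G) (carrier H)"
    using h unfolding iso_def by auto
  have "h ` A = B"
  proof
    show "h ` A \<subseteq> B" using A AB by blast
    show "B \<subseteq> h ` A"
    proof
      fix y assume "y \<in> B"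
      with B bij obtain x where "x \<in> carrier G" "y = h x" unfolding bij_betw_def by auto
      with AB \<open>y \<in> B\<close> show "y \<in> h ` A" by auto
    qed
  qed
  then have "bij_betw h A B" using bij A unfolding bij_betw_def by (blast intro: inj_on_subset)
  moreover have "h \<in> hom (G\<lparr>carrier := A\<rparr>) (H\<lparr>carrier := B\<rparr>)"
    using hom A \<open>h ` A = B\<close> unfolding hom_def by auto
  ultimately show ?thesis unfolding iso_def by simp
qed

section \<open>The stabilizer of the first column\<close>

definition sign_count :: "nat \<Rightarrow> (nat \<Rightarrow> int) \<Rightarrow> nat" where
  "sign_count m e = card {i \<in> {1..m}. e i = 1}"

definition stabilizer_carrier :: "nat \<Rightarrow> ((nat \<Rightarrow> int) \<times> (nat \<Rightarrow> nat)) set" where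
  "stabilizer_carrier m = {(e, \<sigma>) \<in> carrier (signed_perms m). \<sigma> 1 = 1 \<and> e 1 = 0}"

text \<open>
  Labels are shifted down by one, so that \<open>2, \<dots>, m + 1\<close> become \<open>1, \<dots>, m\<close>.
\<close>

definition drop_first :: "nat \<Rightarrow> (nat \<Rightarrow> int) \<times> (nat \<Rightarrow> nat) \<Rightarrow> (nat \<Rightarrow> int) \<times> (nat \<Rightarrow> nat)" where
  "drop_first m = (\<lambda>(e, \<sigma>). (\<lambda>i\<in>{1..m}. e (Suc i), \<lambda>i. \<sigma> (Suc i) - 1))"

text \<open>
  A permutation of \<open>{1..m + 1}\<close> fixes \<open>0\<close>, so a positive argument has a positive value and the
  truncated subtraction in \<open>drop_first\<close> loses nothing.
\<close>

lemma Suc_pred_permutes: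
  assumes \<sigma>: "\<sigma> permutes {1..Suc m}"
  shows "Suc (\<sigma> (Suc i) - 1) = \<sigma> (Suc i)"
proof -
  have "\<sigma> (Suc i) \<noteq> 0"
    using permutes_not_in[OF \<sigma>, of 0] permutes_inj[OF \<sigma>] by (metis atLeastAtMost_iff injD nat.distinct(1) not_one_le_zero)
  then show ?thesis by simp
qed

lemma drop_first_permutes:
  assumes \<sigma>: "\<sigma> permutes {1..Suc m}" and one: "\<sigma> 1 = 1"
  shows "(\<lambda>i. \<sigma> (Suc i) - 1) permutes {1..m}"
proof (rule bij_imp_permutes)
  let ?\<tau> = "\<lambda>i. \<sigma> (Suc i) - 1"
  have inj: "inj \<sigma>" using permutes_inj[OF \<sigma>] .
  have "inj ?\<tau>"
  proof (rule injI)
    fix i j assume "?\<tau> i = ?\<tau> j"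
    then have "\<sigma> (Suc i) = \<sigma> (Suc j)" using Suc_pred_permutes[OF \<sigma>] by metis
    then show "i = j" using inj by (auto dest: injD)
  qed
  moreover have "?\<tau> i \<in> {1..m}" if "i \<in> {1..m}" for i
  proof -
    have "\<sigma> (Suc i) \<in> {1..Suc m}" using permutes_in_image[OF \<sigma>] that by auto
    moreover have "\<sigma> (Suc i) \<noteq> 1" using injD[OF inj, of "Suc i" 1] one that by auto
    ultimately show ?thesis by auto
  qed
  then have "?\<tau> ` {1..m} \<subseteq> {1..m}" by blast
  ultimately show "bij_betw ?\<tau> {1..m} {1..m}"
    unfolding bij_betw_def by (meson endo_inj_surj finite_atLeastAtMost inj_on_subset subset_UNIV)
  show "?\<tau> i = i" if "i \<notin> {1..m}" for i
    using that one permutes_not_in[OF \<sigma>, of "Suc i"] by (cases "i = 0") auto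
qed

text \<open>
  A signed permutation that fixes the first label with a plus sign is an arbitrary signed
  permutation of the remaining labels.
\<close>

lemma drop_first_iso:
  "drop_first m \<in> iso ((signed_perms (Suc m))\<lparr>carrier := stabilizer_carrier (Suc m)\<rparr>) (signed_perms m)"
proof -
  let ?S = "stabilizer_carrier (Suc m)" and ?h = "drop_first m"
  have S: "(e, \<sigma>) \<in> ?S \<longleftrightarrow> e \<in> extensional {1..Suc m} \<and> (\<forall>i\<in>{1..Suc m}. e i = 0 \<or> e i = 1) \<and>
      \<sigma> permutes {1..Suc m} \<and> \<sigma> 1 = 1 \<and> e 1 = 0" for e \<sigma>
    unfolding stabilizer_carrier_def by (auto simp: carrier_signed_perms)
  have into: "?h x \<in> carrier (signed_perms m)" if "x \<in> ?S" for x
    using that drop_first_permutes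
    by (cases x) (auto simp: S drop_first_def carrier_signed_perms)
  have "?h (x \<otimes>\<^bsub>signed_perms (Suc m)\<^esub> y) = ?h x \<otimes>\<^bsub>signed_perms m\<^esub> ?h y"
    if xy: "x \<in> ?S" "y \<in> ?S" for x y
  proof -
    obtain e \<sigma> where x: "x = (e, \<sigma>)" by (cases x)
    obtain d \<tau> where y: "y = (d, \<tau>)" by (cases y)
    have \<sigma>: "\<sigma> permutes {1..Suc m}" "\<sigma> 1 = 1" and \<tau>: "\<tau> permutes {1..Suc m}"
      using xy by (auto simp: S x y)
    let ?\<sigma> = "\<lambda>i. \<sigma> (Suc i) - 1"
    have \<sigma>': "?\<sigma> permutes {1..m}" using drop_first_permutes[OF \<sigma>] .
    have "inv_perm ?\<sigma> i \<in> {1..m} \<and> Suc (inv_perm ?\<sigma> i) = inv_perm \<sigma> (Suc i)" if "i \<in> {1..m}" for i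
    proof
      let ?j = "inv_perm ?\<sigma> i"
      show "?j \<in> {1..m}" using permutes_in_image[OF permutes_inv[OF \<sigma>']] that by blast
      have "?\<sigma> ?j = i" using permutes_inverses(1)[OF \<sigma>'] .
      then have "\<sigma> (Suc ?j) = Suc i" using Suc_pred_permutes[OF \<sigma>(1)] by metis
      then show "Suc ?j = inv_perm \<sigma> (Suc i)" using permutes_inverses(2)[OF \<sigma>(1)] by metis
    qed
    then show ?thesis
      using Suc_pred_permutes[OF \<tau>]
      by (auto simp: x y drop_first_def mult_signed_perms fun_eq_iff restrict_def)
  qed
  moreover have "bij_betw ?h ?S (carrier (signed_perms m))"
  proof -
    define k where "k = (\<lambda>(e :: nat \<Rightarrow> int, \<sigma>).
      (\<lambda>i\<in>{1..Suc m}. if i = 1 then 0 else e (i - 1),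
       \<lambda>i. case i of 0 \<Rightarrow> 0 | Suc j \<Rightarrow> Suc (\<sigma> j)))"
    have "k x \<in> ?S \<and> ?h (k x) = x" if "x \<in> carrier (signed_perms m)" for x
    proof -
      obtain e \<sigma> where x: "x = (e, \<sigma>)" by (cases x)
      have e: "e \<in> extensional {1..m}" "\<forall>i\<in>{1..m}. e i = 0 \<or> e i = 1" and \<sigma>: "\<sigma> permutes {1..m}"
        using that by (auto simp: x carrier_signed_perms)
      have \<sigma>0: "\<sigma> 0 = 0" using permutes_not_in[OF \<sigma>] by auto
      let ?\<tau> = "\<lambda>i. case i of 0 \<Rightarrow> 0 | Suc j \<Rightarrow> Suc (\<sigma> j)"
      have "?\<tau> permutes {1..Suc m}"
      proof (rule bij_imp_permutes)
        have "inj ?\<tau>"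
        proof (rule injI)
          fix i j assume "?\<tau> i = ?\<tau> j"
          then show "i = j" using injD[OF permutes_inj[OF \<sigma>]] by (cases i; cases j) auto
        qed
        moreover have "?\<tau> i \<in> {1..Suc m}" if "i \<in> {1..Suc m}" for i
        proof -
          from that obtain j where "i = Suc j" "j \<le> m" by (cases i) auto
          then show ?thesis using permutes_in_image[OF \<sigma>, of j] \<sigma>0 by (cases "j = 0") auto
        qed
        then have "?\<tau> ` {1..Suc m} \<subseteq> {1..Suc m}" by blast
        ultimately show "bij_betw ?\<tau> {1..Suc m} {1..Suc m}"
          unfolding bij_betw_def by (meson endo_inj_surj finite_atLeastAtMost inj_on_subset subset_UNIV)
        show "?\<tau> i = i" if "i \<notin> {1..Suc m}" for i
          using that permutes_not_in[OF \<sigma>] by (cases i) auto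
      qed
      moreover have "?h (k x) = x"
        using e(1) by (auto simp: x k_def drop_first_def extensional_def fun_eq_iff)
      moreover have "e (i - 1) = 0 \<or> e (i - 1) = 1" if "i \<in> {1..Suc m}" "i \<noteq> 1" for i
      proof -
        have "i - 1 \<in> {1..m}" using that by auto
        then show ?thesis using e(2) by blast
      qed
      ultimately show ?thesis
        using \<sigma>0 by (simp add: x k_def S)
    qed
    moreover have "k (?h x) = x" if "x \<in> ?S" for x
    proof -
      obtain e \<sigma> where x: "x = (e, \<sigma>)" by (cases x)
      have e: "e \<in> extensional {1..Suc m}" "e 1 = 0" and \<sigma>: "\<sigma> permutes {1..Suc m}"
        using that by (auto simp: x S)
      have "\<sigma> 0 = 0" using permutes_not_in[OF \<sigma>] by auto
      then have "(\<lambda>i. case i of 0 \<Rightarrow> 0 | Suc j \<Rightarrow> Suc (\<sigma> (Suc j) - 1)) = \<sigma>"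
        using Suc_pred_permutes[OF \<sigma>] by (auto simp: fun_eq_iff split: nat.split)
      moreover have "(\<lambda>i\<in>{1..Suc m}. if i = 1 then 0 else (\<lambda>i\<in>{1..m}. e (Suc i)) (i - 1)) = e"
        using e by (auto simp: fun_eq_iff extensional_def)
      ultimately show ?thesis unfolding x k_def drop_first_def prod.case by (simp only:)
    qed
    ultimately show ?thesis using into by (intro bij_betw_byWitness[where f' = k]) auto
  qed
  ultimately show ?thesis using into unfolding iso_def hom_def by auto
qed

text \<open>
  The sign that is dropped is a plus sign, so evenness survives the passage from the stabilizer in
  \<open>m + 1\<close> labels to the signed permutations of \<open>m\<close> labels.
\<close>

lemma sign_count_drop_first:
  assumes "e 1 = 0"
  shows "sign_count m (fst (drop_first m (e, \<sigma>))) = sign_count (Suc m) e"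
proof -
  have "{i \<in> {1..Suc m}. e i = 1} = Suc ` {i \<in> {1..m}. e (Suc i) = 1}"
  proof (intro equalityI subsetI)
    fix i assume i: "i \<in> {i \<in> {1..Suc m}. e i = 1}"
    then obtain j where j: "i = Suc j" by (cases i) auto
    have "j \<noteq> 0"
    proof
      assume "j = 0"
      with i j assms show False by simp
    qed
    with i j show "i \<in> Suc ` {i \<in> {1..m}. e (Suc i) = 1}" by auto
  qed auto
  moreover have "{i \<in> {1..m}. fst (drop_first m (e, \<sigma>)) i = 1} = {i \<in> {1..m}. e (Suc i) = 1}"
    by (auto simp: drop_first_def)
  ultimately show ?thesis unfolding sign_count_def by (simp add: card_image)
qed

lemma even_automorphism_iff:
  assumes n: "n \<ge> 3" and g: "g \<in> carrier (automorphism_group n)"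
  shows "(\<exists>\<sigma> N. acts_by n g \<sigma> N \<and> even (card N)) \<longleftrightarrow>
    even (sign_count n (fst (signed_perm_of n g)))"
proof -
  obtain \<sigma> N where act: "acts_by n g \<sigma> N"
    using generate_generators_acts_by[OF n, of g] g unfolding automorphism_group_def by auto
  have "N \<subseteq> {1..n}" using act unfolding acts_by_def by blast
  then have "{i \<in> {1..n}. (\<lambda>i\<in>{1..n}. of_bool (i \<in> N) :: int) i = 1} = N" by auto
  then have "sign_count n (fst (signed_perm_of n g)) = card N"
    unfolding signed_perm_of_eq[OF n act] sign_count_def by simp
  then show ?thesis using acts_by_unique[OF n act] act by metis
qed

lemma fixes_canonical_solution_iff:
  assumes n: "n \<ge> 3" and g: "g \<in> carrier (automorphism_group n)"
  shows "(\<exists>\<sigma> N. acts_by n g \<sigma> N \<and> \<sigma> 1 = 1 \<and> 1 \<notin> N) \<longleftrightarrow>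
    signed_perm_of n g \<in> stabilizer_carrier n"
proof -
  obtain \<sigma> N where act: "acts_by n g \<sigma> N"
    using generate_generators_acts_by[OF n, of g] g unfolding automorphism_group_def by auto
  have "signed_perm_of n g \<in> carrier (signed_perms n)"
    using signed_perm_of_iso[OF n] g unfolding iso_def bij_betw_def by auto
  then have "signed_perm_of n g \<in> stabilizer_carrier n \<longleftrightarrow> \<sigma> 1 = 1 \<and> 1 \<notin> N"
    using n unfolding signed_perm_of_eq[OF n act] stabilizer_carrier_def by auto
  then show ?thesis using acts_by_unique[OF n act] act by metis
qed

lemma even_signed_perms_eq:
  "even_signed_perms m = (signed_perms m)
     \<lparr>carrier := {x \<in> carrier (signed_perms m). even (sign_count m (fst x))}\<rparr>"
  unfolding even_signed_perms_def sign_count_def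
  by (intro arg_cong2[of _ _ _ _ "\<lambda>c G. G\<lparr>carrier := c\<rparr>"]) auto

theorem theorem3p1:
  fixes n :: nat
  assumes "n \<ge> 3"
  shows "(automorphism_group n \<cong> signed_perms n) \<and>
         (even_automorphism_group n \<cong> even_signed_perms n) \<and>
         (canonical_transformations n (automorphism_group n) \<cong> signed_perms (n - 1)) \<and>
         (canonical_transformations n (even_automorphism_group n) \<cong> even_signed_perms (n - 1))"
proof (intro conjI)
  let ?A = "automorphism_group n" and ?B = "signed_perms n" and ?h = "signed_perm_of n"
  let ?E = "\<lambda>m. {x. even (sign_count m (fst x))}" and ?S = "stabilizer_carrier n"
  note iso = signed_perm_of_iso[OF assms] and even_iff = even_automorphism_iff[OF assms]
    and fix_iff = fixes_canonical_solution_iff[OF assms]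
  have into: "?h g \<in> carrier ?B" if "g \<in> carrier ?A" for g
    using iso that unfolding iso_def bij_betw_def by auto
  have S: "?S \<subseteq> carrier ?B" unfolding stabilizer_carrier_def by auto
  obtain m where m: "n = Suc m" using assms by (cases n) auto
  show "?A \<cong> ?B" using iso by (rule is_isoI)
  show "even_automorphism_group n \<cong> even_signed_perms n"
    unfolding even_automorphism_group_def even_signed_perms_eq
    by (rule is_isoI[OF iso_restrict_carriers[OF iso]]) (use into even_iff in auto)
  have "canonical_transformations n ?A \<cong> ?B\<lparr>carrier := ?S\<rparr>"
    unfolding canonical_transformations_def
    by (rule is_isoI[OF iso_restrict_carriers[OF iso]]) (use fix_iff S in auto)
  also have "\<dots> \<cong> signed_perms (n - 1)"
    using is_isoI[OF drop_first_iso] unfolding m by simp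
  finally (iso_trans) show "canonical_transformations n ?A \<cong> signed_perms (n - 1)" .
  have "canonical_transformations n (even_automorphism_group n) \<cong> ?B\<lparr>carrier := ?S \<inter> ?E n\<rparr>"
    unfolding canonical_transformations_def even_automorphism_group_def
    using is_isoI[OF iso_restrict_carriers[OF iso, of
        "{g \<in> {g \<in> carrier ?A. \<exists>\<sigma> N. acts_by n g \<sigma> N \<and> even (card N)}.
          \<exists>\<sigma> N. acts_by n g \<sigma> N \<and> \<sigma> 1 = 1 \<and> 1 \<notin> N}" "?S \<inter> ?E n"]] even_iff fix_iff S
    by simp blast
  moreover have "\<dots> \<cong> even_signed_perms (n - 1)"
  proof -
    have "drop_first m \<in> iso (?B\<lparr>carrier := ?S, carrier := ?S \<inter> ?E n\<rparr>)
      ((signed_perms m)\<lparr>carrier := carrier (signed_perms m) \<inter> ?E m\<rparr>)"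
      using drop_first_iso[of m] unfolding m[symmetric]
    proof (rule iso_restrict_carriers)
      fix x assume x: "x \<in> carrier (?B\<lparr>carrier := ?S\<rparr>)"
      then have "drop_first m x \<in> carrier (signed_perms m)"
        using drop_first_iso[of m] unfolding m[symmetric] iso_def bij_betw_def by auto
      then show "x \<in> ?S \<inter> ?E n \<longleftrightarrow> drop_first m x \<in> carrier (signed_perms m) \<inter> ?E m"
        using x sign_count_drop_first[of "fst x" m "snd x"]
        by (cases x) (auto simp: m stabilizer_carrier_def)
    qed auto
    then show ?thesis
      unfolding even_signed_perms_eq using is_isoI by (auto simp: m Int_def)
  qed
  ultimately show "canonical_transformations n (even_automorphism_group n) \<cong> even_signed_perms (n - 1)"
    by (rule iso_trans)
qed

end
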